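(* Let $N$ be a compact smooth manifold of dimension $n\ge 2$, let $u:N\times(-\infty,0)\to\mathbb{R}$ be a smooth function, and let $h(t)$, $t\in(-\infty,0)$, be a smooth family of Riemannian metrics on $N$. Write $u(t)=u(\cdot,t)$, and let $M=N\times_u\mathbb{R}$ be the warped product, that is, the manifold $N\times\mathbb{R}$ equipped with the family of metrics $$g(t)=h(t)+e^{2u(t)}\,ds^2,\qquad t\in(-\infty,0),$$ where $s$ is the standard coordinate on $\mathbb{R}$. Assume that $(M,g(t))$, $-\infty<t<0$, is an ancient solution to the Ricci flow, i.e. $$\partial_t g(t)=-2\,Rc(g(t)),\qquad -\infty<t<0.$$ Then $u$ is a constant on $N\times(-\infty,0)$; that is, $M$ is a direct product with $(N,h(t))$, $-\infty<t<0$, being an ancient solution to the Ricci flow.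
   Context: $Rc(g)$ denotes the Ricci curvature tensor of a Riemannian metric $g$. An ancient solution to the Ricci flow on a manifold $X$ is a smooth family of Riemannian metrics $g(t)$, $-\infty<t<0$, on $X$ with $\partial_t g(t)=-2Rc(g(t))$ for all $t\in(-\infty,0)$. By the usual convention, manifolds are connected and without boundary. *)

theory Defs
  imports "HOL-Analysis.Analysis"
begin

section \<open>Smooth maps between open subsets of Euclidean spaces\<close>

primrec times_differentiable_on ::
  "nat \<Rightarrow> ('a::euclidean_space \<Rightarrow> 'b::euclidean_space) \<Rightarrow> 'a set \<Rightarrow> bool" where
  "times_differentiable_on 0 f S \<longleftrightarrow> continuous_on S f"
| "times_differentiable_on (Suc k) f S \<longleftrightarrow>
     (\<forall>x\<in>S. f differentiable (at x)) \<and>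
     (\<forall>v. times_differentiable_on k (\<lambda>x. frechet_derivative f (at x) v) S)"

text \<open>Only used for open \<open>S\<close>, so that values of \<open>f\<close> outside \<open>S\<close> do not matter.\<close>

definition smooth_on :: "('a::euclidean_space \<Rightarrow> 'b::euclidean_space) \<Rightarrow> 'a set \<Rightarrow> bool" where
  "smooth_on f S \<longleftrightarrow> (\<forall>k. times_differentiable_on k f S)"

section \<open>Smooth manifolds\<close>

text \<open>A chart is a coordinate domain together with its coordinate map; the map is only
  meaningful on the domain. The dimension of a manifold is the dimension of the Euclidean space
  it is modelled on.\<close>

type_synonym ('a, 'e) chart = "'a set \<times> ('a \<Rightarrow> 'e)"

record ('a, 'e) manifold =
  topo :: "'a topology"
  charts :: "('a, 'e) chart set"

abbreviation chart_dom :: "('a, 'e) chart \<Rightarrow> 'a set" where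
  "chart_dom c \<equiv> fst c"

abbreviation coord :: "('a, 'e) chart \<Rightarrow> 'a \<Rightarrow> 'e" where
  "coord c \<equiv> snd c"

definition img :: "('a, 'e) chart \<Rightarrow> 'e set" where
  "img c = coord c ` chart_dom c"

definition inv_coord :: "('a, 'e) chart \<Rightarrow> 'e \<Rightarrow> 'a" where
  "inv_coord c = inv_into (chart_dom c) (coord c)"

definition transition :: "('a, 'e) chart \<Rightarrow> ('a, 'e) chart \<Rightarrow> 'e \<Rightarrow> 'e" where
  "transition c c' = coord c' \<circ> inv_coord c"

definition second_countable_top :: "'a topology \<Rightarrow> bool" where
  "second_countable_top X \<longleftrightarrow>
     (\<exists>\<B>. countable \<B> \<and> (\<forall>V\<in>\<B>. openin X V) \<and>
          (\<forall>U p. openin X U \<and> p \<in> U \<longrightarrow> (\<exists>V\<in>\<B>. p \<in> V \<and> V \<subseteq> U)))"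

text \<open>The atlas need not be maximal; it determines the smooth structure.\<close>

definition smooth_manifold :: "('a, 'e::euclidean_space) manifold \<Rightarrow> bool" where
  "smooth_manifold M \<longleftrightarrow>
     Hausdorff_space (topo M) \<and> second_countable_top (topo M) \<and> connected_space (topo M) \<and>
     (\<Union>c\<in>charts M. chart_dom c) = topspace (topo M) \<and>
     (\<forall>c\<in>charts M.
        openin (topo M) (chart_dom c) \<and> open (img c) \<and>
        homeomorphic_map (subtopology (topo M) (chart_dom c)) (top_of_set (img c)) (coord c)) \<and>
     (\<forall>c\<in>charts M. \<forall>c'\<in>charts M.
        smooth_on (transition c c') (coord c ` (chart_dom c \<inter> chart_dom c')))"

definition prod_chart :: "('a, 'e) chart \<Rightarrow> ('b, 'f) chart \<Rightarrow> ('a \<times> 'b, 'e \<times> 'f) chart" where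
  "prod_chart c d = (chart_dom c \<times> chart_dom d, map_prod (coord c) (coord d))"

definition prod_manifold ::
  "('a, 'e) manifold \<Rightarrow> ('b, 'f) manifold \<Rightarrow> ('a \<times> 'b, 'e \<times> 'f) manifold" where
  "prod_manifold M N =
     \<lparr>topo = prod_topology (topo M) (topo N),
      charts = {prod_chart c d |c d. c \<in> charts M \<and> d \<in> charts N}\<rparr>"

definition real_line :: "(real, real) manifold" where
  "real_line = \<lparr>topo = euclidean, charts = {(UNIV, \<lambda>s. s)}\<rparr>"

section \<open>Covariant 2-tensors and Riemannian metrics\<close>

text \<open>
  A tangent vector at a point \<open>p\<close> is given by its component vector \<open>v\<close> with respect to a chart \<open>c\<close>
  around \<open>p\<close>; in another chart \<open>c'\<close> the same tangent vector has as components the image of \<open>v\<close>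
  under the derivative of the coordinate change. A covariant 2-tensor field assigns to a chart
  \<open>c\<close>, a point \<open>p\<close> of its domain and two component vectors with respect to \<open>c\<close> a real number, such
  that the result depends only on the tangent vectors and not on the chart.
\<close>

type_synonym ('a, 'e) tensor2 = "('a, 'e) chart \<Rightarrow> 'a \<Rightarrow> 'e \<Rightarrow> 'e \<Rightarrow> real"

definition tensor2_field :: "('a, 'e::euclidean_space) manifold \<Rightarrow> ('a, 'e) tensor2 \<Rightarrow> bool" where
  "tensor2_field M g \<longleftrightarrow>
     (\<forall>c\<in>charts M. \<forall>p\<in>chart_dom c. bilinear (g c p)) \<and>
     (\<forall>c\<in>charts M. \<forall>c'\<in>charts M. \<forall>p\<in>chart_dom c \<inter> chart_dom c'. \<forall>v w.
        g c p v w =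
          g c' p (frechet_derivative (transition c c') (at (coord c p)) v)
                 (frechet_derivative (transition c c') (at (coord c p)) w))"

definition local_rep :: "('a, 'e) chart \<Rightarrow> ('a, 'e) tensor2 \<Rightarrow> 'e \<Rightarrow> 'e \<Rightarrow> 'e \<Rightarrow> real" where
  "local_rep c g = (\<lambda>x. g c (inv_coord c x))"

definition riemannian_metric :: "('a, 'e::euclidean_space) manifold \<Rightarrow> ('a, 'e) tensor2 \<Rightarrow> bool" where
  "riemannian_metric M g \<longleftrightarrow>
     tensor2_field M g \<and>
     (\<forall>c\<in>charts M. \<forall>v w. smooth_on (\<lambda>x. local_rep c g x v w) (img c)) \<and>
     (\<forall>c\<in>charts M. \<forall>p\<in>chart_dom c.
        (\<forall>v w. g c p v w = g c p w v) \<and> (\<forall>v. v \<noteq> 0 \<longrightarrow> g c p v v > 0))"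

text \<open>Differential of a real function, on a tangent vector with components \<open>v\<close> in the chart \<open>c\<close>.\<close>

definition differential ::
  "('a, 'e::euclidean_space) chart \<Rightarrow> ('a \<Rightarrow> real) \<Rightarrow> 'a \<Rightarrow> 'e \<Rightarrow> real" where
  "differential c f p v = frechet_derivative (f \<circ> inv_coord c) (at (coord c p)) v"

text \<open>Pullback of a tensor field \<open>g\<close> on \<open>N\<close> along a smooth map \<open>f\<close> into \<open>N\<close>; by the
  transformation law the choice of the chart around \<open>f p\<close> is irrelevant.\<close>

definition pullback ::
  "('b, 'f::euclidean_space) manifold \<Rightarrow> ('a \<Rightarrow> 'b) \<Rightarrow> ('b, 'f) tensor2 \<Rightarrow>
   ('a, 'e::euclidean_space) tensor2" where
  "pullback N f g = (\<lambda>c p v w.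
     let d = (SOME d. d \<in> charts N \<and> f p \<in> chart_dom d);
         D = frechet_derivative (coord d \<circ> f \<circ> inv_coord c) (at (coord c p))
     in g d (f p) (D v) (D w))"

definition product_metric ::
  "('a, 'e::euclidean_space) manifold \<Rightarrow> ('b, 'f::euclidean_space) manifold \<Rightarrow>
   ('a, 'e) tensor2 \<Rightarrow> ('b, 'f) tensor2 \<Rightarrow> ('a \<times> 'b, 'e \<times> 'f) tensor2" where
  "product_metric M N g h = (\<lambda>c q v w. pullback M fst g c q v w + pullback N snd h c q v w)"

definition line_metric :: "(real, real) tensor2" where
  "line_metric = (\<lambda>c s v w. differential c (\<lambda>s. s) s v * differential c (\<lambda>s. s) s w)"

text \<open>The metric \<open>h + e\<^sup>2\<^sup>u ds\<^sup>2\<close> on the product of \<open>N\<close> with the real line.\<close>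

definition warped_metric ::
  "('a, 'e::euclidean_space) manifold \<Rightarrow> ('a, 'e) tensor2 \<Rightarrow> ('a \<Rightarrow> real) \<Rightarrow>
   ('a \<times> real, 'e \<times> real) tensor2" where
  "warped_metric N h u = (\<lambda>c q v w.
     pullback N fst h c q v w + exp (2 * u (fst q)) * (differential c snd q v * differential c snd q w))"

section \<open>Ricci curvature\<close>

text \<open>
  In a chart, with \<open>G x v w\<close> the local representation of the metric: \<open>christoffel G x v w\<close> is
  the covariant derivative at \<open>x\<close>, in direction \<open>v\<close>, of the vector field with constant components
  \<open>w\<close>, i.e. the vector with components \<open>\<Gamma>\<^sup>k\<^sub>i\<^sub>j v\<^sup>i w\<^sup>j\<close>. It is determined by the Koszul formula
  \<open>g(\<nabla>\<^sub>v w, z) = (v g(w,z) + w g(v,z) - z g(v,w)) / 2\<close>, constant fields having vanishing Lie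
  brackets.
\<close>

definition christoffel ::
  "('e::euclidean_space \<Rightarrow> 'e \<Rightarrow> 'e \<Rightarrow> real) \<Rightarrow> 'e \<Rightarrow> 'e \<Rightarrow> 'e \<Rightarrow> 'e" where
  "christoffel G x v w = (THE y. \<forall>z. G x y z =
     (frechet_derivative (\<lambda>x. G x w z) (at x) v
      + frechet_derivative (\<lambda>x. G x v z) (at x) w
      - frechet_derivative (\<lambda>x. G x v w) (at x) z) / 2)"

text \<open>\<open>R(a,b)w = \<nabla>\<^sub>a \<nabla>\<^sub>b w - \<nabla>\<^sub>b \<nabla>\<^sub>a w\<close> for fields \<open>a\<close>, \<open>b\<close>, \<open>w\<close> with constant components.\<close>

definition riemann_curvature ::
  "('e::euclidean_space \<Rightarrow> 'e \<Rightarrow> 'e \<Rightarrow> real) \<Rightarrow> 'e \<Rightarrow> 'e \<Rightarrow> 'e \<Rightarrow> 'e \<Rightarrow> 'e" where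
  "riemann_curvature G x a b w =
     frechet_derivative (\<lambda>x. christoffel G x b w) (at x) a
     - frechet_derivative (\<lambda>x. christoffel G x a w) (at x) b
     + christoffel G x a (christoffel G x b w)
     - christoffel G x b (christoffel G x a w)"

text \<open>\<open>Rc(v,w)\<close> is the trace of \<open>a \<mapsto> R(a,v)w\<close>; the inner product of the model space only serves
  to read off coordinates.\<close>

definition ricci :: "('a, 'e::euclidean_space) tensor2 \<Rightarrow> ('a, 'e) tensor2" where
  "ricci g = (\<lambda>c p v w.
     \<Sum>b\<in>Basis. riemann_curvature (local_rep c g) (coord c p) b v w \<bullet> b)"

section \<open>Ancient solutions to the Ricci flow\<close>

text \<open>Smoothness of time-dependent objects is joint smoothness in space and time.\<close>

definition smooth_ancient_function ::
  "('a, 'e::euclidean_space) manifold \<Rightarrow> ('a \<times> real \<Rightarrow> real) \<Rightarrow> bool" where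
  "smooth_ancient_function M u \<longleftrightarrow>
     (\<forall>c\<in>charts M. smooth_on (\<lambda>(x, t). u (inv_coord c x, t)) (img c \<times> {..<0}))"

definition smooth_ancient_metrics ::
  "('a, 'e::euclidean_space) manifold \<Rightarrow> (real \<Rightarrow> ('a, 'e) tensor2) \<Rightarrow> bool" where
  "smooth_ancient_metrics M g \<longleftrightarrow>
     (\<forall>t<0. riemannian_metric M (g t)) \<and>
     (\<forall>c\<in>charts M. \<forall>v w.
        smooth_on (\<lambda>(x, t). local_rep c (g t) x v w) (img c \<times> {..<0}))"

definition ancient_ricci_flow ::
  "('a, 'e::euclidean_space) manifold \<Rightarrow> (real \<Rightarrow> ('a, 'e) tensor2) \<Rightarrow> bool" where
  "ancient_ricci_flow M g \<longleftrightarrow>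
     smooth_ancient_metrics M g \<and>
     (\<forall>t<0. \<forall>c\<in>charts M. \<forall>p\<in>chart_dom c. \<forall>v w.
        ((\<lambda>\<tau>. g \<tau> c p v w) has_real_derivative - 2 * ricci (g t) c p v w) (at t))"

end

theory Submission
  imports Defs
begin

text \<open>
Write \<open>\<phi> = |\<nabla>u|\<^sup>2\<close>, everything taken with respect to \<open>h(t)\<close>. The Ricci tensor of
\<open>h + e\<^sup>2\<^sup>u ds\<^sup>2\<close> has the horizontal part \<open>Rc(h) - \<nabla>\<^sup>2u - du du\<close>, the vertical part
\<open>- e\<^sup>2\<^sup>u (\<Delta>u + \<phi>)\<close> (\<open>ricci_warped_horizontal\<close>, \<open>ricci_warped_vertical\<close>), so the flow on the
warped product amounts to the system
\<open>\<partial>\<^sub>t h = - 2 Rc(h) + 2 \<nabla>\<^sup>2u + 2 du du\<close> and \<open>\<partial>\<^sub>t u = \<Delta>u + \<phi>\<close> on \<open>N\<close> (\<open>local_flow_chart\<close>).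

From this system and the Bochner formula one gets
\<open>\<partial>\<^sub>t \<phi> = \<Delta>\<phi> + \<langle>\<nabla>u, \<nabla>\<phi>\<rangle> - 2 |\<nabla>\<^sup>2u|\<^sup>2 - 2 \<phi>\<^sup>2\<close>: the curvature term of the Bochner formula cancels
against the one from \<open>\<partial>\<^sub>t h\<close>, and the term \<open>2 du du\<close> that comes from the warping leaves the
quadratic damping \<open>- 2 \<phi>\<^sup>2\<close>. Only the consequence \<open>\<partial>\<^sub>t \<phi> \<le> - 2 \<phi>\<^sup>2\<close> at a spatial
maximum of \<open>\<phi>\<close> is used (\<open>bochner_at_max\<close>, \<open>grad_square_decays_at_max\<close>).

The solutions of \<open>y' = - 2 y\<^sup>2\<close> obey the bound \<open>y \<le> 1 / (2 (t - t\<^sub>0))\<close>, whatever their value at the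
initial time \<open>t\<^sub>0\<close>. Since \<open>N\<close> is compact, the maximum principle transfers this to
\<open>\<phi> \<le> 1 / (2 (t - t\<^sub>0))\<close> (\<open>time_weighted_gradient_bound\<close>). The solution is ancient, so \<open>t\<^sub>0\<close> may be
sent to \<open>-\<infinity>\<close>, which gives \<open>\<phi> = 0\<close> (\<open>gradient_square_zero\<close>). Then \<open>u\<close> is locally constant in
space, \<open>\<partial>\<^sub>t u = 0\<close>, and the equation for \<open>h\<close> becomes the Ricci flow; connectedness of \<open>N\<close> makes
\<open>u\<close> constant.

The differential geometry takes place in a chart, on an open subset of a Euclidean space. To avoid
indices and inverse metrics, the gradient is a vector field \<open>X\<close> determined by \<open>h(X, z) = du(z)\<close>,
the Hessian is the endomorphism \<open>A = \<nabla>X\<close>, which is self-adjoint for \<open>h\<close>, and the Laplacian is the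
trace of \<open>A\<close>. Of the inner product \<open>h\<close> the argument then needs two things, both obtained from the
Gram-Schmidt process (\<open>smooth_orthogonal_frame\<close>): the vector that represents a functional depends
smoothly on parameters, and an endomorphism \<open>T\<close> with \<open>h(v, T v) \<ge> 0\<close> has a trace \<open>\<ge> 0\<close>.
\<close>

section \<open>Calculus of smooth maps\<close>

abbreviation dd :: "('a::euclidean_space \<Rightarrow> 'b::euclidean_space) \<Rightarrow> 'a \<Rightarrow> 'a \<Rightarrow> 'b" where
  "dd f x v \<equiv> frechet_derivative f (at x) v"

lemma dd_eqI: "(f has_derivative f') (at x) \<Longrightarrow> dd f x v = f' v"
  using frechet_derivative_at by metis

text \<open>No differentiability is assumed: even the arbitrary value that stands for the derivative of a
non-differentiable function depends only on the germ. Thus formulas that are valid on an open set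
may be substituted inside \<open>christoffel\<close> and \<open>riemann_curvature\<close> without further ado.\<close>

lemma frechet_derivative_local_cong:
  assumes "open S" "x \<in> S" "\<And>y. y \<in> S \<Longrightarrow> f y = g y"
  shows "frechet_derivative f (at x) = frechet_derivative g (at x)"
proof -
  have "(f has_derivative D) (at x) \<longleftrightarrow> (g has_derivative D) (at x)" for D
    using assms has_derivative_transform_within_open by (metis (no_types, lifting))
  then show ?thesis unfolding frechet_derivative_def by simp
qed

lemma differentiable_local_cong:
  assumes "f differentiable (at x)" "open S" "x \<in> S" "\<And>y. y \<in> S \<Longrightarrow> f y = g y"
  shows "g differentiable (at x)"
  using assms has_derivative_transform_within_open unfolding differentiable_def by blast

lemma times_differentiable_cong:
  assumes "open S" "\<And>x. x \<in> S \<Longrightarrow> f x = g x" "times_differentiable_on k f S"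
  shows "times_differentiable_on k g S"
  using assms(2,3)
proof (induction k arbitrary: f g)
  case 0
  then show ?case by (simp cong: continuous_on_cong)
next
  case (Suc k)
  have "g differentiable (at x)" if "x \<in> S" for x
    using Suc.prems differentiable_local_cong[OF _ assms(1) that, of f g] that by simp
  moreover have "times_differentiable_on k (\<lambda>x. dd g x v) S" for v
    using Suc.IH[of "\<lambda>x. dd f x v" "\<lambda>x. dd g x v"] Suc.prems
      frechet_derivative_local_cong[OF assms(1), of _ f g] by auto
  ultimately show ?case by simp
qed

lemma times_differentiable_SucD:
  "times_differentiable_on (Suc k) f S \<Longrightarrow> times_differentiable_on k f S"
proof (induction k arbitrary: f)
  case 0
  then show ?case
    by (simp add: differentiable_imp_continuous_on differentiable_on_def differentiable_at_withinI)
next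
  case (Suc k)
  then show ?case by (metis times_differentiable_on.simps(2))
qed

text \<open>The coinductive reading of smoothness, which makes the order \<open>k\<close> disappear from later arguments.\<close>

lemma smooth_on_iff_dd:
  "smooth_on f S \<longleftrightarrow> (\<forall>x\<in>S. f differentiable (at x)) \<and> (\<forall>v. smooth_on (\<lambda>x. dd f x v) S)"
  unfolding smooth_on_def
  by (metis times_differentiable_SucD times_differentiable_on.simps(2))

lemma smooth_on_dd: "smooth_on f S \<Longrightarrow> smooth_on (\<lambda>x. dd f x v) S"
  using smooth_on_iff_dd by blast

lemma smooth_on_has_derivative:
  "smooth_on f S \<Longrightarrow> x \<in> S \<Longrightarrow> (f has_derivative frechet_derivative f (at x)) (at x)"
  using smooth_on_iff_dd frechet_derivative_works by blast

lemma smooth_on_linear_dd: "smooth_on f S \<Longrightarrow> x \<in> S \<Longrightarrow> linear (frechet_derivative f (at x))"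
  using smooth_on_iff_dd linear_frechet_derivative by blast

lemma smooth_on_continuous: "smooth_on f S \<Longrightarrow> continuous_on S f"
  unfolding smooth_on_def by (metis times_differentiable_on.simps(1))

lemma smooth_on_cong:
  assumes "smooth_on f S" "open S" "\<And>x. x \<in> S \<Longrightarrow> f x = g x"
  shows "smooth_on g S"
  using assms times_differentiable_cong unfolding smooth_on_def by metis

lemma smooth_on_const: "smooth_on (\<lambda>x. c) S"
proof -
  have "times_differentiable_on k (\<lambda>x. c) S" for k
    by (induction k arbitrary: c) auto
  then show ?thesis unfolding smooth_on_def by blast
qed

lemma smooth_on_bounded_linear:
  assumes "bounded_linear f"
  shows "smooth_on f S"
proof -
  have d: "dd f x v = f v" for x v
    using assms bounded_linear_imp_has_derivative dd_eqI by blast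
  have "f differentiable (at x)" for x
    using assms bounded_linear_imp_has_derivative differentiableI by blast
  then show ?thesis by (subst smooth_on_iff_dd) (simp add: d smooth_on_const)
qed

lemma times_differentiable_add:
  assumes "open S" "times_differentiable_on k f S" "times_differentiable_on k g S"
  shows "times_differentiable_on k (\<lambda>x. f x + g x) S"
  using assms(2,3)
proof (induction k arbitrary: f g)
  case 0
  then show ?case by (simp add: continuous_on_add)
next
  case (Suc k)
  have "dd f x v + dd g x v = dd (\<lambda>x. f x + g x) x v" if "x \<in> S" for x v
    using Suc.prems that
    by (intro dd_eqI[symmetric] has_derivative_add) (auto simp: frechet_derivative_works)
  then have "times_differentiable_on k (\<lambda>x. dd (\<lambda>x. f x + g x) x v) S" for v
    by (rule times_differentiable_cong[OF assms(1) _ Suc.IH[of "\<lambda>x. dd f x v" "\<lambda>x. dd g x v"]])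
      (use Suc.prems in auto)
  then show ?case using Suc.prems by simp
qed

lemma times_differentiable_sum:
  assumes "open S" "\<And>i. i \<in> I \<Longrightarrow> times_differentiable_on k (f i) S"
  shows "times_differentiable_on k (\<lambda>x. \<Sum>i\<in>I. f i x) S"
  using assms(2)
  by (induction I rule: infinite_finite_induct)
    (use smooth_on_const[of 0 S] in \<open>auto simp: smooth_on_def intro: times_differentiable_add assms(1)\<close>)

lemma times_differentiable_bilinear:
  assumes "bounded_bilinear b" "open S"
    and "times_differentiable_on k f S" "times_differentiable_on k g S"
  shows "times_differentiable_on k (\<lambda>x. b (f x) (g x)) S"
  using assms(3,4)
proof (induction k arbitrary: f g)
  case 0
  then show ?case by (simp add: bounded_bilinear.continuous_on[OF assms(1)])
next
  case (Suc k)
  have der: "((\<lambda>x. b (f x) (g x)) has_derivative (\<lambda>v. b (f x) (dd g x v) + b (dd f x v) (g x))) (at x)"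
    if "x \<in> S" for x
    using Suc.prems that
    by (intro bounded_bilinear.FDERIV[OF assms(1)]) (auto simp: frechet_derivative_works)
  have "times_differentiable_on k (\<lambda>x. b (f x) (dd g x v) + b (dd f x v) (g x)) S" for v
    using Suc.prems times_differentiable_SucD[OF Suc.prems(1)] times_differentiable_SucD[OF Suc.prems(2)]
    by (intro times_differentiable_add[OF assms(2)] Suc.IH) auto
  then have "times_differentiable_on k (\<lambda>x. dd (\<lambda>x. b (f x) (g x)) x v) S" for v
    by (rule times_differentiable_cong[OF assms(2), rotated]) (use dd_eqI[OF der] in auto)
  then show ?case using der by (auto simp: differentiable_def)
qed

text \<open>The derivative of a composition is expanded in a basis, so that it becomes a sum of products of
functions to which the induction hypothesis on \<open>k\<close> applies.\<close>

lemma times_differentiable_compose: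
  fixes f :: "'b::euclidean_space \<Rightarrow> 'c::euclidean_space" and g :: "'a::euclidean_space \<Rightarrow> 'b"
  assumes "open S" "open T" "g ` S \<subseteq> T"
    and "times_differentiable_on k f T" "times_differentiable_on k g S"
  shows "times_differentiable_on k (\<lambda>x. f (g x)) S"
  using assms(4,5)
proof (induction k arbitrary: f)
  case 0
  then show ?case using assms(3) continuous_on_compose2[of T f S g] by simp
next
  case (Suc k)
  have der: "((\<lambda>x. f (g x)) has_derivative (\<lambda>v. dd f (g x) (dd g x v))) (at x)" if "x \<in> S" for x
  proof -
    have 1: "(g has_derivative frechet_derivative g (at x)) (at x)"
      using Suc.prems that by (auto simp: frechet_derivative_works)
    have 2: "(f has_derivative frechet_derivative f (at (g x))) (at (g x))"
      using Suc.prems that assms(3) by (auto simp: frechet_derivative_works)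
    show ?thesis using has_derivative_compose[OF 1 2] .
  qed
  have "dd (\<lambda>x. f (g x)) x v = (\<Sum>i\<in>Basis. (dd g x v \<bullet> i) *\<^sub>R dd f (g x) i)" if "x \<in> S" for x v
  proof -
    have "linear (frechet_derivative f (at (g x)))"
      using Suc.prems that assms(3) by (auto intro: linear_frechet_derivative)
    then have "dd f (g x) (\<Sum>i\<in>Basis. (dd g x v \<bullet> i) *\<^sub>R i) = (\<Sum>i\<in>Basis. (dd g x v \<bullet> i) *\<^sub>R dd f (g x) i)"
      by (simp add: linear_sum linear_scale)
    then show ?thesis using dd_eqI[OF der[OF that]] by (simp add: euclidean_representation)
  qed
  moreover have "times_differentiable_on k (\<lambda>x. \<Sum>i\<in>Basis. (dd g x v \<bullet> i) *\<^sub>R dd f (g x) i) S" for v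
    using Suc.prems smooth_on_const times_differentiable_SucD[OF Suc.prems(2)]
    by (intro times_differentiable_sum times_differentiable_bilinear[OF bounded_bilinear_scaleR]
        times_differentiable_bilinear[OF bounded_bilinear_inner] Suc.IH assms(1))
       (auto simp: smooth_on_def)
  then have "times_differentiable_on k (\<lambda>x. dd (\<lambda>x. f (g x)) x v) S" for v
    by (rule times_differentiable_cong[OF assms(1), rotated]) (use calculation in auto)
  then show ?case using der by (auto simp: differentiable_def)
qed

lemma smooth_on_add:
  "open S \<Longrightarrow> smooth_on f S \<Longrightarrow> smooth_on g S \<Longrightarrow> smooth_on (\<lambda>x. f x + g x) S"
  by (auto simp: smooth_on_def intro: times_differentiable_add)

lemma smooth_on_sum:
  "open S \<Longrightarrow> (\<And>i. i \<in> I \<Longrightarrow> smooth_on (f i) S) \<Longrightarrow> smooth_on (\<lambda>x. \<Sum>i\<in>I. f i x) S"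
  by (auto simp: smooth_on_def intro: times_differentiable_sum)

lemma smooth_on_bilinear:
  "bounded_bilinear b \<Longrightarrow> open S \<Longrightarrow> smooth_on f S \<Longrightarrow> smooth_on g S \<Longrightarrow>
   smooth_on (\<lambda>x. b (f x) (g x)) S"
  by (auto simp: smooth_on_def intro: times_differentiable_bilinear)

lemma smooth_on_compose:
  "open S \<Longrightarrow> open T \<Longrightarrow> g ` S \<subseteq> T \<Longrightarrow> smooth_on f T \<Longrightarrow> smooth_on g S \<Longrightarrow>
   smooth_on (\<lambda>x. f (g x)) S"
  unfolding smooth_on_def using times_differentiable_compose by blast

lemmas smooth_on_scaleR = smooth_on_bilinear[OF bounded_bilinear_scaleR]
lemmas smooth_on_mult = smooth_on_bilinear[OF bounded_bilinear_mult]
lemmas smooth_on_inner = smooth_on_bilinear[OF bounded_bilinear_inner]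

lemma smooth_on_bounded_linear_compose:
  assumes "bounded_linear L" "open S" "smooth_on f S"
  shows "smooth_on (\<lambda>x. L (f x)) S"
  using smooth_on_compose[OF assms(2) open_UNIV _ smooth_on_bounded_linear[OF assms(1)] assms(3)] by simp

lemma smooth_on_minus: "open S \<Longrightarrow> smooth_on f S \<Longrightarrow> smooth_on (\<lambda>x. - f x) S"
  by (rule smooth_on_bounded_linear_compose[OF bounded_linear_minus[OF bounded_linear_ident]])

lemma smooth_on_diff:
  "open S \<Longrightarrow> smooth_on f S \<Longrightarrow> smooth_on g S \<Longrightarrow> smooth_on (\<lambda>x. f x - g x) S"
  using smooth_on_add[of S f "\<lambda>x. - g x"] smooth_on_minus[of S g] by simp

lemma smooth_on_inverse:
  fixes f :: "'a::euclidean_space \<Rightarrow> real"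
  assumes "open S" "smooth_on f S" "\<And>x. x \<in> S \<Longrightarrow> f x \<noteq> 0"
  shows "smooth_on (\<lambda>x. inverse (f x)) S"
proof -
  have op: "open (- {0::real})" by auto
  have "times_differentiable_on k inverse (- {0::real})" for k
  proof (induction k)
    case 0
    then show ?case by (auto intro: continuous_intros)
  next
    case (Suc k)
    have der: "(inverse has_derivative (\<lambda>v. - (inverse x * v * inverse x))) (at x)"
      if "x \<noteq> 0" for x :: real
      using has_derivative_inverse'[OF that, of UNIV] by simp
    have c: "times_differentiable_on k (\<lambda>x. c) (- {0::real})" for c :: real
      using smooth_on_const by (auto simp: smooth_on_def)
    have "times_differentiable_on k (\<lambda>x. (-v) * (inverse x * inverse x)) (- {0::real})" for v :: real
      by (intro times_differentiable_bilinear[OF bounded_bilinear_mult op] Suc c)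
    then have "times_differentiable_on k (\<lambda>x. dd inverse x v) (- {0::real})" for v
      by (rule times_differentiable_cong[OF op, rotated]) (use dd_eqI[OF der] in auto)
    then show ?case using der by (auto simp: differentiable_def)
  qed
  then have "smooth_on inverse (- {0::real})" by (simp add: smooth_on_def)
  then show ?thesis using smooth_on_compose[OF assms(1) op, of f inverse] assms by fastforce
qed

lemma smooth_on_divide:
  fixes f g :: "'a::euclidean_space \<Rightarrow> real"
  assumes "open S" "smooth_on f S" "smooth_on g S" "\<And>x. x \<in> S \<Longrightarrow> g x \<noteq> 0"
  shows "smooth_on (\<lambda>x. f x / g x) S"
  unfolding divide_inverse by (intro smooth_on_mult smooth_on_inverse assms)

lemma smooth_on_exp:
  fixes f :: "'a::euclidean_space \<Rightarrow> real"
  assumes "open S" "smooth_on f S"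
  shows "smooth_on (\<lambda>x. exp (f x)) S"
proof -
  have der: "(exp has_derivative (\<lambda>v. v * exp x)) (at x)" for x :: real
    using DERIV_exp[of x] by (simp add: has_field_derivative_def mult_commute_abs)
  have "times_differentiable_on k exp (UNIV::real set)" for k
  proof (induction k)
    case 0
    then show ?case by (auto intro: continuous_intros)
  next
    case (Suc k)
    have "times_differentiable_on k (\<lambda>x. v * exp x) (UNIV::real set)" for v
      using smooth_on_const
      by (intro times_differentiable_bilinear[OF bounded_bilinear_mult open_UNIV] Suc)
        (auto simp: smooth_on_def)
    then show ?case using der dd_eqI[OF der] by (auto simp: differentiable_def)
  qed
  then have "smooth_on exp (UNIV::real set)" by (simp add: smooth_on_def)
  then show ?thesis using smooth_on_compose[OF assms(1) open_UNIV, of f exp] assms by auto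
qed

lemma bounded_linear_inj1: "bounded_linear (\<lambda>x. (x, 0))"
  and bounded_linear_inj2: "bounded_linear (\<lambda>y. (0, y))"
  by (auto intro!: bounded_linear_Pair bounded_linear_zero bounded_linear_ident)

text \<open>Partial derivatives in space and in time are derivatives of the joint function on space-time in the
directions \<open>(v, 0)\<close> and \<open>(0, v)\<close>; this lets them be interchanged later.\<close>

lemma smooth_on_slice_fst:
  assumes "smooth_on f (S \<times> T)" "open S" "open T" "t \<in> T"
  shows "smooth_on (\<lambda>x. f (x, t)) S"
    and "x \<in> S \<Longrightarrow> dd (\<lambda>x. f (x, t)) x v = dd f (x, t) (v, 0)"
proof -
  have "smooth_on (\<lambda>x. (x, 0) + (0, t)) S"
    by (intro smooth_on_add smooth_on_bounded_linear bounded_linear_inj1 smooth_on_const assms)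
  then have *: "smooth_on (\<lambda>x. (x, t)) S" by simp
  show "smooth_on (\<lambda>x. f (x, t)) S"
    using smooth_on_compose[OF assms(2) open_Times[OF assms(2,3)] _ assms(1) *] assms(4) by auto
  assume "x \<in> S"
  have d1: "((\<lambda>x. (x, t)) has_derivative (\<lambda>v. (v, 0))) (at x)"
    by (intro has_derivative_Pair has_derivative_ident has_derivative_const)
  have d2: "(f has_derivative frechet_derivative f (at (x, t))) (at (x, t))"
    using smooth_on_has_derivative[OF assms(1)] \<open>x \<in> S\<close> assms(4) by simp
  show "dd (\<lambda>x. f (x, t)) x v = dd f (x, t) (v, 0)"
    using dd_eqI[OF has_derivative_compose[OF d1 d2]] .
qed

lemma smooth_on_slice_snd:
  assumes "smooth_on f (S \<times> T)" "open S" "open T" "x \<in> S"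
  shows "smooth_on (\<lambda>t. f (x, t)) T"
    and "t \<in> T \<Longrightarrow> dd (\<lambda>t. f (x, t)) t v = dd f (x, t) (0, v)"
proof -
  have "smooth_on (\<lambda>t. (x, 0) + (0, t)) T"
    by (intro smooth_on_add smooth_on_bounded_linear bounded_linear_inj2 smooth_on_const assms)
  then have *: "smooth_on (\<lambda>t. (x, t)) T" by simp
  show "smooth_on (\<lambda>t. f (x, t)) T"
    using smooth_on_compose[OF assms(3) open_Times[OF assms(2,3)] _ assms(1) *] assms(4) by auto
  assume "t \<in> T"
  have d1: "((\<lambda>t. (x, t)) has_derivative (\<lambda>v. (0, v))) (at t)"
    by (intro has_derivative_Pair has_derivative_ident has_derivative_const)
  have d2: "(f has_derivative frechet_derivative f (at (x, t))) (at (x, t))"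
    using smooth_on_has_derivative[OF assms(1)] \<open>t \<in> T\<close> assms(4) by simp
  show "dd (\<lambda>t. f (x, t)) t v = dd f (x, t) (0, v)"
    using dd_eqI[OF has_derivative_compose[OF d1 d2]] .
qed

lemma dd_fst:
  assumes "smooth_on f S" "x \<in> S"
  shows "dd (\<lambda>q. f (fst q)) (x, s) v = dd f x (fst v)"
proof -
  have "((\<lambda>q. f (fst q)) has_derivative (\<lambda>v. dd f x (fst v))) (at (x, s))"
    using has_derivative_compose[OF has_derivative_fst[OF has_derivative_ident], of f _ "(x, s)" UNIV]
      smooth_on_has_derivative[OF assms] by simp
  then show ?thesis by (rule dd_eqI)
qed

lemma dd_const [simp]: "dd (\<lambda>x. c) x v = 0" by simp

lemma dd_cong:
  "open S \<Longrightarrow> x \<in> S \<Longrightarrow> (\<And>y. y \<in> S \<Longrightarrow> f y = g y) \<Longrightarrow> dd f x v = dd g x v"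
  using frechet_derivative_local_cong[of S x f g] by simp

lemma dd_add:
  assumes "smooth_on f S" "smooth_on g S" "x \<in> S"
  shows "dd (\<lambda>x. f x + g x) x v = dd f x v + dd g x v"
  using dd_eqI[OF has_derivative_add] smooth_on_has_derivative assms by blast

lemma dd_sum:
  assumes "\<And>i. i \<in> I \<Longrightarrow> smooth_on (f i) S" "x \<in> S"
  shows "dd (\<lambda>x. \<Sum>i\<in>I. f i x) x v = (\<Sum>i\<in>I. dd (f i) x v)"
proof -
  have "((\<lambda>x. \<Sum>i\<in>I. f i x) has_derivative (\<lambda>v. \<Sum>i\<in>I. dd (f i) x v)) (at x)"
    using smooth_on_has_derivative assms by (intro has_derivative_sum) blast
  then show ?thesis by (rule dd_eqI)
qed

lemma dd_bounded_linear:
  assumes "bounded_linear L" "smooth_on f S" "x \<in> S"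
  shows "dd (\<lambda>x. L (f x)) x v = L (dd f x v)"
  using dd_eqI[OF bounded_linear.has_derivative[OF assms(1) smooth_on_has_derivative[OF assms(2,3)]]] .

lemma dd_bilinear:
  assumes "bounded_bilinear b" "smooth_on f S" "smooth_on g S" "x \<in> S"
  shows "dd (\<lambda>x. b (f x) (g x)) x v = b (f x) (dd g x v) + b (dd f x v) (g x)"
  using dd_eqI[OF bounded_bilinear.FDERIV[OF assms(1) smooth_on_has_derivative[OF assms(2,4)]
    smooth_on_has_derivative[OF assms(3,4)]]] .

lemma dd_exp:
  fixes f :: "'a::euclidean_space \<Rightarrow> real"
  assumes "smooth_on f S" "x \<in> S"
  shows "dd (\<lambda>x. exp (f x)) x v = dd f x v * exp (f x)"
  using dd_eqI[OF has_derivative_exp[OF smooth_on_has_derivative[OF assms]]] .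

lemma dd_along_line:
  fixes f :: "'a::euclidean_space \<Rightarrow> real"
  assumes "smooth_on f S" "x + s *\<^sub>R a \<in> S"
  shows "((\<lambda>s. f (x + s *\<^sub>R a)) has_real_derivative dd f (x + s *\<^sub>R a) a) (at s)"
proof -
  have "((\<lambda>s. x + s *\<^sub>R a) has_derivative (\<lambda>r. r *\<^sub>R a)) (at s)"
    by (auto intro!: derivative_eq_intros)
  then have "((\<lambda>s. f (x + s *\<^sub>R a)) has_derivative (\<lambda>r. dd f (x + s *\<^sub>R a) (r *\<^sub>R a))) (at s)"
    using smooth_on_has_derivative[OF assms] by (rule has_derivative_compose)
  then show ?thesis
    using linear_scale[OF smooth_on_linear_dd[OF assms]]
    by (simp add: has_field_derivative_def mult_commute_abs)
qed

section \<open>Second derivatives\<close>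

text \<open>The mean value theorem, first in the direction \<open>a\<close> and then in the direction \<open>b\<close>, turns the second
difference over a parallelogram into a mixed second derivative at some point of it. The second
difference is symmetric in \<open>a\<close> and \<open>b\<close>.\<close>

lemma second_difference_mean_value:
  fixes f :: "'a::euclidean_space \<Rightarrow> real"
  assumes f: "smooth_on f S" and "r > 0"
    and S: "\<And>s t. 0 \<le> s \<Longrightarrow> s \<le> r \<Longrightarrow> 0 \<le> t \<Longrightarrow> t \<le> r \<Longrightarrow> x + t *\<^sub>R b + s *\<^sub>R a \<in> S"
  obtains \<xi> \<eta> where "0 \<le> \<xi>" "\<xi> \<le> r" "0 \<le> \<eta>" "\<eta> \<le> r"
    "f (x + r *\<^sub>R b + r *\<^sub>R a) - f (x + r *\<^sub>R a) - f (x + r *\<^sub>R b) + f x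
      = r * r * dd (\<lambda>y. dd f y a) (x + \<eta> *\<^sub>R b + \<xi> *\<^sub>R a) b"
proof -
  have "((\<lambda>s. f (x + r *\<^sub>R b + s *\<^sub>R a) - f (x + s *\<^sub>R a)) has_real_derivative
      dd f (x + r *\<^sub>R b + s *\<^sub>R a) a - dd f (x + s *\<^sub>R a) a) (at s)" if "0 \<le> s" "s \<le> r" for s
    using dd_along_line[OF f] S[of s r] S[of s 0] that by (intro DERIV_diff) auto
  from MVT2[OF assms(2) this] obtain \<xi> where \<xi>: "0 < \<xi>" "\<xi> < r"
    "f (x + r *\<^sub>R b + r *\<^sub>R a) - f (x + r *\<^sub>R a) - (f (x + r *\<^sub>R b) - f x) =
     r * (dd f (x + r *\<^sub>R b + \<xi> *\<^sub>R a) a - dd f (x + \<xi> *\<^sub>R a) a)"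
    by auto
  have "((\<lambda>t. dd f (x + \<xi> *\<^sub>R a + t *\<^sub>R b) a) has_real_derivative
      dd (\<lambda>y. dd f y a) (x + \<xi> *\<^sub>R a + t *\<^sub>R b) b) (at t)" if "0 \<le> t" "t \<le> r" for t
  proof -
    have "x + \<xi> *\<^sub>R a + t *\<^sub>R b \<in> S" using S[of \<xi> t] that \<xi> by (simp add: add_ac)
    then show ?thesis using dd_along_line[OF smooth_on_dd[OF f]] by blast
  qed
  from MVT2[OF assms(2) this] obtain \<eta> where \<eta>: "0 < \<eta>" "\<eta> < r"
    "dd f (x + \<xi> *\<^sub>R a + r *\<^sub>R b) a - dd f (x + \<xi> *\<^sub>R a) a =
     r * dd (\<lambda>y. dd f y a) (x + \<xi> *\<^sub>R a + \<eta> *\<^sub>R b) b"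
    by auto
  show ?thesis
    using that[of \<xi> \<eta>] \<xi> \<eta> by (simp add: add_ac)
qed

text \<open>Both mixed derivatives are values of the same second difference at points that tend to \<open>x\<close>, hence
they agree by continuity.\<close>

lemma dd_commute_real:
  fixes f :: "'a::euclidean_space \<Rightarrow> real"
  assumes f: "smooth_on f S" and "open S" "x \<in> S"
  shows "dd (\<lambda>y. dd f y a) x b = dd (\<lambda>y. dd f y b) x a"
proof -
  define F where "F = (\<lambda>y. dd (\<lambda>y. dd f y a) y b)"
  define G where "G = (\<lambda>y. dd (\<lambda>y. dd f y b) y a)"
  have "continuous_on S F" "continuous_on S G"
    unfolding F_def G_def by (intro smooth_on_continuous smooth_on_dd f)+
  then have "isCont F x" "isCont G x"
    using assms by (auto simp: continuous_on_eq_continuous_at)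
  have "\<bar>F x - G x\<bar> < e" if "e > 0" for e
  proof -
    have "e / 2 > 0" using that by simp
    then have "\<exists>d>0. \<forall>y. dist y x < d \<longrightarrow> dist (F y) (F x) < e / 2"
      "\<exists>d>0. \<forall>y. dist y x < d \<longrightarrow> dist (G y) (G x) < e / 2"
      using \<open>isCont F x\<close> \<open>isCont G x\<close> unfolding continuous_at_eps_delta by blast+
    then obtain d1 d2 where d1: "d1 > 0" "\<And>y. dist y x < d1 \<Longrightarrow> \<bar>F y - F x\<bar> < e / 2"
      and d2: "d2 > 0" "\<And>y. dist y x < d2 \<Longrightarrow> \<bar>G y - G x\<bar> < e / 2"
      unfolding dist_real_def by blast
    obtain d3 where d3: "d3 > 0" "\<And>y. dist y x < d3 \<Longrightarrow> y \<in> S"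
      using assms by (meson open_dist)
    define d where "d = min d1 (min d2 d3)"
    \<comment> \<open>the side length for which the whole parallelogram lies within distance \<open>d\<close> of \<open>x\<close>\<close>
    define r where "r = d / (1 + norm a + norm b)"
    have d: "d > 0" using d1 d2 d3 by (simp add: d_def)
    have na: "1 + norm a + norm b > 0" using norm_ge_zero[of a] norm_ge_zero[of b] by linarith
    then have r: "r > 0" and rd: "r * (1 + norm a + norm b) = d"
      using d by (auto simp: r_def)
    have near: "dist (x + t *\<^sub>R b + s *\<^sub>R a) x < d" if "0 \<le> s" "s \<le> r" "0 \<le> t" "t \<le> r" for s t
    proof -
      have "norm (t *\<^sub>R b + s *\<^sub>R a) \<le> t * norm b + s * norm a"
        using norm_triangle_ineq[of "t *\<^sub>R b" "s *\<^sub>R a"] that by simp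
      also have "\<dots> \<le> r * norm b + r * norm a"
        using that by (intro add_mono mult_right_mono) auto
      also have "\<dots> < d" using r rd by (simp add: algebra_simps)
      finally show ?thesis by (simp add: dist_norm add_ac)
    qed
    then have S1: "x + t *\<^sub>R b + s *\<^sub>R a \<in> S" if "0 \<le> s" "s \<le> r" "0 \<le> t" "t \<le> r" for s t
      using that d3 by (simp add: d_def)
    then have S2: "x + t *\<^sub>R a + s *\<^sub>R b \<in> S" if "0 \<le> s" "s \<le> r" "0 \<le> t" "t \<le> r" for s t
      using that by (metis add.assoc add.commute)
    obtain \<xi> \<eta> where 1: "0 \<le> \<xi>" "\<xi> \<le> r" "0 \<le> \<eta>" "\<eta> \<le> r"
      "f (x + r *\<^sub>R b + r *\<^sub>R a) - f (x + r *\<^sub>R a) - f (x + r *\<^sub>R b) + f x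
        = r * r * F (x + \<eta> *\<^sub>R b + \<xi> *\<^sub>R a)"
      using second_difference_mean_value[OF f r S1] unfolding F_def by blast
    obtain \<xi>' \<eta>' where 2: "0 \<le> \<xi>'" "\<xi>' \<le> r" "0 \<le> \<eta>'" "\<eta>' \<le> r"
      "f (x + r *\<^sub>R a + r *\<^sub>R b) - f (x + r *\<^sub>R b) - f (x + r *\<^sub>R a) + f x
        = r * r * G (x + \<eta>' *\<^sub>R a + \<xi>' *\<^sub>R b)"
      using second_difference_mean_value[OF f r S2] unfolding G_def by blast
    have "f (x + r *\<^sub>R a + r *\<^sub>R b) = f (x + r *\<^sub>R b + r *\<^sub>R a)" by (simp add: add_ac)
    then have "r * r * F (x + \<eta> *\<^sub>R b + \<xi> *\<^sub>R a) = r * r * G (x + \<eta>' *\<^sub>R a + \<xi>' *\<^sub>R b)"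
      using 1(5) 2(5) by linarith
    then have FG: "F (x + \<eta> *\<^sub>R b + \<xi> *\<^sub>R a) = G (x + \<eta>' *\<^sub>R a + \<xi>' *\<^sub>R b)"
      using r by simp
    have "dist (x + \<eta> *\<^sub>R b + \<xi> *\<^sub>R a) x < d" using near[of \<xi> \<eta>] 1(1-4) by simp
    then have "\<bar>F (x + \<eta> *\<^sub>R b + \<xi> *\<^sub>R a) - F x\<bar> < e / 2" using d1 by (simp add: d_def)
    moreover have "dist (x + \<eta>' *\<^sub>R a + \<xi>' *\<^sub>R b) x < d"
      using near[of \<eta>' \<xi>'] 2(1-4) by (simp add: add_ac)
    then have "\<bar>G (x + \<eta>' *\<^sub>R a + \<xi>' *\<^sub>R b) - G x\<bar> < e / 2" using d2 by (simp add: d_def)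
    ultimately show ?thesis using FG by linarith
  qed
  then have "\<bar>F x - G x\<bar> \<le> 0" by (meson not_le less_irrefl)
  then show ?thesis by (simp add: F_def G_def)
qed

lemma dd_commute:
  assumes f: "smooth_on f S" and "open S" "x \<in> S"
  shows "dd (\<lambda>y. dd f y a) x b = dd (\<lambda>y. dd f y b) x a"
proof (rule euclidean_eqI)
  fix i :: 'b
  have "dd (\<lambda>y. dd f y v) x w \<bullet> i = dd (\<lambda>y. dd (\<lambda>z. f z \<bullet> i) y v) x w" for v w
  proof -
    have "dd (\<lambda>y. dd f y v) x w \<bullet> i = dd (\<lambda>y. dd f y v \<bullet> i) x w"
      using dd_bounded_linear[OF bounded_linear_inner_left smooth_on_dd[OF f] assms(3)] by simp
    also have "\<dots> = dd (\<lambda>y. dd (\<lambda>z. f z \<bullet> i) y v) x w"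
      using dd_bounded_linear[OF bounded_linear_inner_left f] by (intro dd_cong[OF assms(2,3)]) simp
    finally show ?thesis .
  qed
  moreover have "smooth_on (\<lambda>z. f z \<bullet> i) S"
    by (rule smooth_on_bounded_linear_compose[OF bounded_linear_inner_left assms(2) f])
  ultimately show "dd (\<lambda>y. dd f y a) x b \<bullet> i = dd (\<lambda>y. dd f y b) x a \<bullet> i"
    using dd_commute_real assms(2,3) by simp
qed

text \<open>If the second derivative in the direction \<open>v\<close> were positive, the first one would be positive shortly
after \<open>x\<close> on the ray in this direction, and the function would exceed its value at \<open>x\<close> there.\<close>

lemma second_derivative_test:
  fixes f :: "'a::euclidean_space \<Rightarrow> real"
  assumes f: "smooth_on f S" and "open S" "x \<in> S" and max: "\<And>y. y \<in> S \<Longrightarrow> f y \<le> f x"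
  shows "dd f x v = 0" and "dd (\<lambda>y. dd f y v) x v \<le> 0"
proof -
  show z: "dd f x v = 0"
    using differential_zero_maxmin[OF assms(3,2) smooth_on_has_derivative[OF f assms(3)]] max
    by (metis (mono_tags))
  show "dd (\<lambda>y. dd f y v) x v \<le> 0"
  proof (rule ccontr)
    assume "\<not> ?thesis"
    then have pos: "dd (\<lambda>y. dd f y v) (x + 0 *\<^sub>R v) v > 0" by simp
    obtain d where d: "d > 0" "\<And>h. h > 0 \<Longrightarrow> h < d \<Longrightarrow> dd f x v < dd f (x + h *\<^sub>R v) v"
      using DERIV_pos_inc_right[OF dd_along_line[OF smooth_on_dd[OF f, of v], of x 0 v] pos] assms(3)
      by auto
    obtain e where e: "e > 0" "\<And>y. dist y x < e \<Longrightarrow> y \<in> S"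
      using assms by (meson open_dist)
    \<comment> \<open>small enough for the first derivative to be positive up to \<open>h\<close> and for the segment to stay in \<open>S\<close>\<close>
    define h where "h = min (d / 2) (e / (1 + norm v))"
    have nv: "1 + norm v > 0" using norm_ge_zero[of v] by linarith
    then have h: "0 < h" "h < d" using d e by (auto simp: h_def)
    have inS: "x + s *\<^sub>R v \<in> S" if "0 \<le> s" "s \<le> h" for s
    proof (rule e(2))
      have "s * (1 + norm v) \<le> e"
        using that nv by (simp add: h_def field_simps)
      moreover have "s * norm v < e" if "s = 0" using e that by simp
      ultimately have "s * norm v < e"
        using that by (cases "s = 0") (auto simp: algebra_simps)
      then show "dist (x + s *\<^sub>R v) x < e" using that by (simp add: dist_norm)
    qed
    have der: "((\<lambda>s. f (x + s *\<^sub>R v)) has_real_derivative dd f (x + s *\<^sub>R v) v) (at s)"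
      if "0 \<le> s" "s \<le> h" for s
      by (rule dd_along_line[OF f inS[OF that]])
    obtain \<xi> where "0 < \<xi>" "\<xi> < h" "f (x + h *\<^sub>R v) - f (x + 0 *\<^sub>R v) = (h - 0) * dd f (x + \<xi> *\<^sub>R v) v"
      using MVT2[OF h(1) der] by blast
    moreover have "dd f (x + \<xi> *\<^sub>R v) v > 0" using d(2)[of \<xi>] z h calculation by simp
    ultimately have "f (x + h *\<^sub>R v) - f x > 0" using h by (simp add: mult_pos_pos)
    then show False using max[OF inS[of h]] h by simp
  qed
qed

section \<open>Smooth families of linear and bilinear maps\<close>

text \<open>Smoothness of the family is only required for each fixed argument \<open>v\<close>; in finite dimension this
suffices, because \<open>L q (a q)\<close> is a finite sum of components of \<open>a q\<close> times \<open>L q i\<close>. The derivative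
formula is the product rule for the two occurrences of \<open>q\<close>.\<close>

lemma smooth_on_linear_family:
  fixes L :: "'q::euclidean_space \<Rightarrow> 'e::euclidean_space \<Rightarrow> 'f::euclidean_space"
  assumes "open S" "\<And>q. q \<in> S \<Longrightarrow> linear (L q)" "\<And>v. smooth_on (\<lambda>q. L q v) S" "smooth_on a S"
  shows "smooth_on (\<lambda>q. L q (a q)) S"
    and "q \<in> S \<Longrightarrow> dd (\<lambda>q. L q (a q)) q v = dd (\<lambda>q'. L q' (a q)) q v + L q (dd a q v)"
proof -
  have rep: "(\<Sum>i\<in>Basis. (w \<bullet> i) *\<^sub>R L q i) = L q w" if "q \<in> S" for q w
  proof -
    have "(\<Sum>i\<in>Basis. (w \<bullet> i) *\<^sub>R L q i) = L q (\<Sum>i\<in>Basis. (w \<bullet> i) *\<^sub>R i)"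
      using assms(2)[OF that] by (simp add: linear_sum linear_scale)
    then show ?thesis by (simp add: euclidean_representation)
  qed
  have ai: "smooth_on (\<lambda>q. a q \<bullet> i) S" for i
    by (rule smooth_on_bounded_linear_compose[OF bounded_linear_inner_left assms(1,4)])
  have si: "smooth_on (\<lambda>q. (a q \<bullet> i) *\<^sub>R L q i) S" for i
    by (intro smooth_on_scaleR ai assms)
  show "smooth_on (\<lambda>q. L q (a q)) S"
    by (rule smooth_on_cong[OF smooth_on_sum[OF assms(1) si] assms(1) rep])
  assume q: "q \<in> S"
  have "dd (\<lambda>q. L q (a q)) q v = dd (\<lambda>q. \<Sum>i\<in>Basis. (a q \<bullet> i) *\<^sub>R L q i) q v"
    by (rule dd_cong[OF assms(1) q]) (simp add: rep)
  also have "\<dots> = (\<Sum>i\<in>Basis. (a q \<bullet> i) *\<^sub>R dd (\<lambda>q. L q i) q v + (dd a q v \<bullet> i) *\<^sub>R L q i)"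
    using dd_sum[OF si q, where v = v and I = Basis]
      dd_bilinear[OF bounded_bilinear_scaleR ai assms(3) q, where v = v]
      dd_bounded_linear[OF bounded_linear_inner_left assms(4) q, where v = v] by simp
  also have "\<dots> = (\<Sum>i\<in>Basis. (a q \<bullet> i) *\<^sub>R dd (\<lambda>q. L q i) q v) + L q (dd a q v)"
    by (simp add: sum.distrib rep q)
  also have "(\<Sum>i\<in>Basis. (a q \<bullet> i) *\<^sub>R dd (\<lambda>q. L q i) q v) =
      dd (\<lambda>q'. \<Sum>i\<in>Basis. (a q \<bullet> i) *\<^sub>R L q' i) q v"
  proof -
    have s: "smooth_on (\<lambda>q'. (a q \<bullet> i) *\<^sub>R L q' i) S" for i
      by (intro smooth_on_scaleR smooth_on_const assms)
    show ?thesis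
      using dd_sum[of Basis "\<lambda>i q'. (a q \<bullet> i) *\<^sub>R L q' i", OF s q]
        dd_bounded_linear[OF bounded_linear_scaleR_right assms(3) q] by simp
  qed
  also have "\<dots> = dd (\<lambda>q'. L q' (a q)) q v"
    by (rule dd_cong[OF assms(1) q]) (simp add: rep)
  finally show "dd (\<lambda>q. L q (a q)) q v = dd (\<lambda>q'. L q' (a q)) q v + L q (dd a q v)" .
qed

lemma smooth_on_bilinear_family:
  fixes B :: "'q::euclidean_space \<Rightarrow> 'e::euclidean_space \<Rightarrow> 'e2::euclidean_space \<Rightarrow> 'f::euclidean_space"
  assumes "open S" "\<And>q. q \<in> S \<Longrightarrow> bilinear (B q)" "\<And>v w. smooth_on (\<lambda>q. B q v w) S"
    and "smooth_on a S" "smooth_on b S"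
  shows "smooth_on (\<lambda>q. B q (a q) (b q)) S"
    and "q \<in> S \<Longrightarrow> dd (\<lambda>q. B q (a q) (b q)) q v =
      dd (\<lambda>q'. B q' (a q) (b q)) q v + B q (dd a q v) (b q) + B q (a q) (dd b q v)"
proof -
  have l: "linear (\<lambda>v. B q v w)" "linear (\<lambda>w. B q v w)" if "q \<in> S" for q v w
    using assms(2)[OF that] by (auto simp: bilinear_def)
  have s1: "smooth_on (\<lambda>q. B q (a q) w) S" for w
    by (rule smooth_on_linear_family[OF assms(1) l(1) assms(3,4)])
  show "smooth_on (\<lambda>q. B q (a q) (b q)) S"
    by (rule smooth_on_linear_family[OF assms(1) l(2) s1 assms(5)])
  assume q: "q \<in> S"
  show "dd (\<lambda>q. B q (a q) (b q)) q v =
      dd (\<lambda>q'. B q' (a q) (b q)) q v + B q (dd a q v) (b q) + B q (a q) (dd b q v)"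
    using smooth_on_linear_family(2)[OF assms(1) l(2) s1 assms(5) q, where v = v]
      smooth_on_linear_family(2)[OF assms(1) l(1) assms(3,4) q, where v = v] by simp
qed

section \<open>Inner products that depend smoothly on parameters\<close>

definition inner_form :: "('e::euclidean_space \<Rightarrow> 'e \<Rightarrow> real) \<Rightarrow> bool" where
  "inner_form B \<longleftrightarrow> bilinear B \<and> (\<forall>v w. B v w = B w v) \<and> (\<forall>v. v \<noteq> 0 \<longrightarrow> B v v > 0)"

text \<open>The vector that represents the functional \<open>l\<close> with respect to \<open>B\<close>. Gradients and Christoffel symbols
are both of this form.\<close>

definition riesz :: "('e::euclidean_space \<Rightarrow> 'e \<Rightarrow> real) \<Rightarrow> ('e \<Rightarrow> real) \<Rightarrow> 'e" where
  "riesz B l = (THE y. \<forall>z. B y z = l z)"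

lemma inner_form_linear:
  assumes "inner_form B"
  shows "linear (\<lambda>v. B v w)" "linear (B v)"
  using assms by (auto simp: inner_form_def bilinear_def)

lemma inner_form_eqI:
  assumes "inner_form B" "\<And>z. B y z = B y' z"
  shows "y = y'"
proof (rule ccontr)
  assume "y \<noteq> y'"
  then have "B (y - y') (y - y') > 0" using assms(1) by (simp add: inner_form_def)
  then show False
    using linear_diff[OF inner_form_linear(1)[OF assms(1)], of y y' "y - y'"] assms(2) by simp
qed

lemma riesz_eqI:
  assumes "inner_form B" "\<And>z. B y z = l z"
  shows "riesz B l = y"
  unfolding riesz_def
proof (rule the_equality)
  fix y' assume "\<forall>z. B y' z = l z"
  then show "y' = y" using inner_form_eqI[OF assms(1), of y' y] assms(2) by simp
qed (use assms(2) in simp)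

text \<open>Gram-Schmidt without normalisation, so that the frame is a rational expression in the entries of
\<open>B q\<close> and no square roots occur. The set \<open>K\<close> of basis vectors grows by one in each step.\<close>

lemma smooth_orthogonal_frame_partial:
  fixes B :: "'q::euclidean_space \<Rightarrow> 'e::euclidean_space \<Rightarrow> 'e \<Rightarrow> real"
  assumes S: "open S" and B: "\<And>q. q \<in> S \<Longrightarrow> inner_form (B q)"
    and sB: "\<And>v w. smooth_on (\<lambda>q. B q v w) S"
    and K: "finite K" "K \<subseteq> Basis"
  shows "\<exists>e. (\<forall>b\<in>K. smooth_on (e b) S) \<and>
    (\<forall>q\<in>S. (\<forall>a\<in>K. \<forall>b\<in>K. a \<noteq> b \<longrightarrow> B q (e a q) (e b q) = 0) \<and>
      (\<forall>b\<in>K. e b q \<noteq> 0) \<and> span ((\<lambda>b. e b q) ` K) = span K)" (is "\<exists>e. ?P K e")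
  using K
proof (induction K rule: finite_induct)
  case empty
  then show ?case by simp
next
  case (insert b K)
  then obtain e where e: "?P K e" by auto
  have sm: "\<And>a. a \<in> K \<Longrightarrow> smooth_on (e a) S"
    and orth: "\<And>q a c. q \<in> S \<Longrightarrow> a \<in> K \<Longrightarrow> c \<in> K \<Longrightarrow> a \<noteq> c \<Longrightarrow> B q (e a q) (e c q) = 0"
    and nz: "\<And>q a. q \<in> S \<Longrightarrow> a \<in> K \<Longrightarrow> e a q \<noteq> 0"
    and sp: "\<And>q. q \<in> S \<Longrightarrow> span ((\<lambda>a. e a q) ` K) = span K"
    using e by blast+
  have bil: "q \<in> S \<Longrightarrow> bilinear (B q)" and sym: "q \<in> S \<Longrightarrow> B q v w = B q w v"
    and pos: "q \<in> S \<Longrightarrow> v \<noteq> 0 \<Longrightarrow> B q v v > 0" for q v w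
    using B by (auto simp: inner_form_def)
  define c where "c = (\<lambda>a q. B q b (e a q) / B q (e a q) (e a q))"
  define f where "f = (\<lambda>q. b - (\<Sum>a\<in>K. c a q *\<^sub>R e a q))"
  have sBe: "smooth_on (\<lambda>q. B q b (e a q)) S" "smooth_on (\<lambda>q. B q (e a q) (e a q)) S"
    if "a \<in> K" for a
    using smooth_on_bilinear_family(1)[OF S bil sB smooth_on_const sm[OF that], of b]
      smooth_on_bilinear_family(1)[OF S bil sB sm[OF that] sm[OF that]] by auto
  have smf: "smooth_on f S"
    unfolding f_def c_def using pos nz
    by (intro smooth_on_diff smooth_on_const smooth_on_sum smooth_on_scaleR smooth_on_divide sBe sm S)
       (auto simp: less_imp_neq[THEN not_sym])
  have of: "B q (f q) (e a q) = 0" if q: "q \<in> S" and a: "a \<in> K" for q a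
  proof -
    have "B q (f q) (e a q) = B q b (e a q) - (\<Sum>a'\<in>K. c a' q * B q (e a' q) (e a q))"
      using inner_form_linear(1)[OF B[OF q]] unfolding f_def
      by (simp add: linear_diff[of "\<lambda>v. B q v (e a q)"] linear_sum[of "\<lambda>v. B q v (e a q)"]
          linear_scale[of "\<lambda>v. B q v (e a q)"])
    also have "(\<Sum>a'\<in>K. c a' q * B q (e a' q) (e a q)) =
        (\<Sum>a'\<in>K. if a' = a then c a q * B q (e a q) (e a q) else 0)"
      by (rule sum.cong) (use orth[OF q _ a] in auto)
    also have "\<dots> = B q b (e a q)"
      using a insert.hyps pos[OF q nz[OF q a]] by (simp add: c_def)
    finally show ?thesis by simp
  qed
  have comb: "(\<Sum>a\<in>K. c a q *\<^sub>R e a q) \<in> span K" if "q \<in> S" for q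
    using sp[OF that] by (metis (no_types, lifting) imageI span_base span_scale span_sum)
  have "b \<notin> span K"
    using insert independent_Basis by (metis insert_subset independent_mono independent_insert)
  then have nf: "f q \<noteq> 0" if "q \<in> S" for q
    using comb[OF that] by (auto simp: f_def)
  have spf: "span (insert (f q) ((\<lambda>a. e a q) ` K)) = span (insert b K)" if q: "q \<in> S" for q
  proof -
    let ?T = "(\<lambda>a. e a q) ` K"
    have sub: "f q \<in> span (insert b K)" 
      unfolding f_def using comb[OF q] span_mono[of K "insert b K"]
      by (intro span_diff) (auto intro: span_base)
    have "?T \<subseteq> span K" using sp[OF q] span_superset[of ?T] by simp
    then have eK1: "?T \<subseteq> span (insert b K)" using span_mono[of K "insert b K"] by (meson subset_insertI subset_trans)
    have "K \<subseteq> span ?T" using sp[OF q] span_superset[of K] by simp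
    then have eK2: "K \<subseteq> span (insert (f q) ?T)"
      using span_mono[of ?T "insert (f q) ?T"] by (meson subset_insertI subset_trans)
    have "b = f q + (\<Sum>a\<in>K. c a q *\<^sub>R e a q)" by (simp add: f_def)
    moreover have "\<dots> \<in> span (insert (f q) ?T)"
      using comb[OF q] sp[OF q] span_mono[of ?T "insert (f q) ?T"]
      by (intro span_add) (auto intro: span_base)
    ultimately have bin: "b \<in> span (insert (f q) ?T)" by simp
    show ?thesis
      by (rule span_eq[THEN iffD2]) (use sub eK1 eK2 bin span_superset in auto)
  qed
  define e' where "e' = (\<lambda>a. if a = b then f else e a)"
  have [simp]: "e' b = f" and eq: "\<And>a. a \<in> K \<Longrightarrow> e' a = e a"
    using insert.hyps by (auto simp: e'_def)
  have im: "(\<lambda>a. e' a q) ` insert b K = insert (f q) ((\<lambda>a. e a q) ` K)" for q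
    using eq by auto
  show ?case
  proof (intro exI[of _ e'] conjI ballI impI)
    fix q assume q: "q \<in> S"
    show "B q (e' a q) (e' c q) = 0" if "a \<in> insert b K" "c \<in> insert b K" "a \<noteq> c" for a c
      using that orth[OF q, of a c] of[OF q, of a] of[OF q, of c] sym[OF q] eq by auto
    show "e' a q \<noteq> 0" if "a \<in> insert b K" for a
      using that nz[OF q] nf[OF q] eq by auto
    show "span ((\<lambda>b. e' b q) ` insert b K) = span (insert b K)"
      unfolding im by (rule spf[OF q])
  qed (use sm smf eq in auto)
qed

text \<open>The last two clauses express orthogonality and completeness of the frame in the form in which they
are used: a functional is represented by the vector with the Fourier coefficients
\<open>l(e\<^sub>a) / B(e\<^sub>a, e\<^sub>a)\<close>.\<close>

definition orthogonal_frame ::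
  "'q::euclidean_space set \<Rightarrow> ('q \<Rightarrow> 'e::euclidean_space \<Rightarrow> 'e \<Rightarrow> real) \<Rightarrow> ('e \<Rightarrow> 'q \<Rightarrow> 'e) \<Rightarrow> bool" where
  "orthogonal_frame S B e \<longleftrightarrow>
    (\<forall>a\<in>Basis. smooth_on (e a) S) \<and>
    (\<forall>q\<in>S. (\<forall>a\<in>Basis. B q (e a q) (e a q) > 0) \<and>
      (\<forall>l. linear l \<longrightarrow>
        riesz (B q) l = (\<Sum>a\<in>Basis. (l (e a q) / B q (e a q) (e a q)) *\<^sub>R e a q) \<and>
        (\<forall>z. B q (riesz (B q) l) z = l z)))"

lemma smooth_orthogonal_frame:
  fixes B :: "'q::euclidean_space \<Rightarrow> 'e::euclidean_space \<Rightarrow> 'e \<Rightarrow> real"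
  assumes S: "open S" and B: "\<And>q. q \<in> S \<Longrightarrow> inner_form (B q)"
    and sB: "\<And>v w. smooth_on (\<lambda>q. B q v w) S"
  shows "\<exists>e. orthogonal_frame S B e"
proof -
  have "\<exists>e :: 'e \<Rightarrow> 'q \<Rightarrow> 'e. (\<forall>b\<in>Basis. smooth_on (e b) S) \<and>
    (\<forall>q\<in>S. (\<forall>a\<in>Basis. \<forall>b\<in>Basis. a \<noteq> b \<longrightarrow> B q (e a q) (e b q) = 0) \<and>
      (\<forall>b\<in>Basis. e b q \<noteq> 0) \<and> span ((\<lambda>b. e b q) ` Basis) = span Basis)"
    (is "\<exists>e. ?P e")
    by (rule smooth_orthogonal_frame_partial) (use S B sB in auto)
  then obtain e where e: "?P e" by (rule exE)
  have sm: "\<And>a. a \<in> Basis \<Longrightarrow> smooth_on (e a) S"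
    and orth: "\<And>q a c. q \<in> S \<Longrightarrow> a \<in> Basis \<Longrightarrow> c \<in> Basis \<Longrightarrow> a \<noteq> c \<Longrightarrow> B q (e a q) (e c q) = 0"
    and nz: "\<And>q a. q \<in> S \<Longrightarrow> a \<in> Basis \<Longrightarrow> e a q \<noteq> 0"
    and sp0: "\<And>q. q \<in> S \<Longrightarrow> span ((\<lambda>a. e a q) ` Basis) = span Basis"
    using e by blast+
  have sp: "span ((\<lambda>a. e a q) ` Basis) = UNIV" if "q \<in> S" for q
    using sp0[OF that] by simp
  have pos: "B q (e a q) (e a q) > 0" if "q \<in> S" "a \<in> Basis" for q a
    using B nz that by (auto simp: inner_form_def)
  have r: "B q (\<Sum>a\<in>Basis. (l (e a q) / B q (e a q) (e a q)) *\<^sub>R e a q) z = l z"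
    if q: "q \<in> S" and l: "linear l" for q l z
  proof (rule linear_eq_on_span[of "B q _" l "(\<lambda>a. e a q) ` Basis", OF inner_form_linear(2)[OF B[OF q]] l])
    fix w assume "w \<in> (\<lambda>a. e a q) ` Basis"
    then obtain c where c: "c \<in> Basis" "w = e c q" by blast
    have "B q (\<Sum>a\<in>Basis. (l (e a q) / B q (e a q) (e a q)) *\<^sub>R e a q) w =
        (\<Sum>a\<in>Basis. (l (e a q) / B q (e a q) (e a q)) * B q (e a q) w)"
      using inner_form_linear(1)[OF B[OF q]]
      by (simp add: linear_sum[of "\<lambda>v. B q v w"] linear_scale[of "\<lambda>v. B q v w"])
    also have "\<dots> = (\<Sum>a\<in>Basis. if a = c then l w else 0)"
      using orth[OF q _ c(1)] pos[OF q c(1)] c by (intro sum.cong) auto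
    also have "\<dots> = l w" using c by simp
    finally show "B q (\<Sum>a\<in>Basis. (l (e a q) / B q (e a q) (e a q)) *\<^sub>R e a q) w = l w" .
  qed (use sp[OF q] in auto)
  then have r2: "riesz (B q) l = (\<Sum>a\<in>Basis. (l (e a q) / B q (e a q) (e a q)) *\<^sub>R e a q)"
    if "q \<in> S" "linear l" for q l
    using that by (intro riesz_eqI B) auto
  show ?thesis using sm pos r r2 unfolding orthogonal_frame_def by (intro exI[of _ e]) auto
qed

text \<open>A single inner product is treated as a constant family with a real parameter.\<close>

lemma riesz_works:
  fixes B :: "'e::euclidean_space \<Rightarrow> 'e \<Rightarrow> real"
  assumes "inner_form B" "linear l"
  shows "B (riesz B l) z = l z"
proof -
  have "\<exists>e. orthogonal_frame (UNIV :: real set) (\<lambda>_. B) e"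
    by (rule smooth_orthogonal_frame) (auto intro: assms smooth_on_const)
  then show ?thesis using assms(2) unfolding orthogonal_frame_def by blast
qed

text \<open>The Fourier expansion in an orthogonal frame is an explicit smooth formula for the representing
vector; it replaces Cramer's rule for the inverse metric.\<close>

lemma smooth_on_riesz:
  fixes B :: "'q::euclidean_space \<Rightarrow> 'e::euclidean_space \<Rightarrow> 'e \<Rightarrow> real"
  assumes S: "open S" and B: "\<And>q. q \<in> S \<Longrightarrow> inner_form (B q)"
    and sB: "\<And>v w. smooth_on (\<lambda>q. B q v w) S"
    and l: "\<And>q. q \<in> S \<Longrightarrow> linear (l q)" and sl: "\<And>z. smooth_on (\<lambda>q. l q z) S"
  shows "smooth_on (\<lambda>q. riesz (B q) (l q)) S"
proof -
  have "\<exists>e. orthogonal_frame S B e"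
    by (rule smooth_orthogonal_frame) (use S B sB in auto)
  then obtain e where e: "orthogonal_frame S B e" by (rule exE)
  have sm: "\<And>a. a \<in> Basis \<Longrightarrow> smooth_on (e a) S"
    and pos: "\<And>q a. q \<in> S \<Longrightarrow> a \<in> Basis \<Longrightarrow> B q (e a q) (e a q) > 0"
    and r: "\<And>q l. q \<in> S \<Longrightarrow> linear l \<Longrightarrow> riesz (B q) l = (\<Sum>a\<in>Basis. (l (e a q) / B q (e a q) (e a q)) *\<^sub>R e a q)"
    using e unfolding orthogonal_frame_def by blast+
  have bil: "q \<in> S \<Longrightarrow> bilinear (B q)" for q using B by (auto simp: inner_form_def)
  have "smooth_on (\<lambda>q. \<Sum>a\<in>Basis. (l q (e a q) / B q (e a q) (e a q)) *\<^sub>R e a q) S"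
    by (intro smooth_on_sum smooth_on_scaleR smooth_on_divide S smooth_on_linear_family(1)[OF S l sl]
        smooth_on_bilinear_family(1)[OF S bil sB] sm)
      (use pos in \<open>auto simp: less_imp_neq[THEN not_sym]\<close>)
  then show ?thesis by (rule smooth_on_cong[OF _ S]) (simp add: r l)
qed

section \<open>Traces of endomorphisms\<close>

definition endo_trace :: "('e::euclidean_space \<Rightarrow> 'e) \<Rightarrow> real" where
  "endo_trace T = (\<Sum>b\<in>Basis. T b \<bullet> b)"

lemma endo_trace_add: "endo_trace (\<lambda>v. S v + T v) = endo_trace S + endo_trace T"
  and endo_trace_diff: "endo_trace (\<lambda>v. S v - T v) = endo_trace S - endo_trace T"
  and endo_trace_scaleR: "endo_trace (\<lambda>v. r *\<^sub>R S v) = r * endo_trace S"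
  by (simp_all add: endo_trace_def inner_add_left inner_diff_left sum.distrib sum_subtractf sum_distrib_left)

lemma endo_trace_commute:
  fixes P Q :: "'e::euclidean_space \<Rightarrow> 'e"
  assumes "linear P" "linear Q"
  shows "endo_trace (\<lambda>v. P (Q v)) = endo_trace (\<lambda>v. Q (P v))"
proof -
  have e: "F (G b) \<bullet> b = (\<Sum>a\<in>Basis. (G b \<bullet> a) * (F a \<bullet> b))" if "linear F" for F G :: "'e \<Rightarrow> 'e" and b
  proof -
    have "F (G b) = F (\<Sum>a\<in>Basis. (G b \<bullet> a) *\<^sub>R a)" by (simp add: euclidean_representation)
    also have "\<dots> = (\<Sum>a\<in>Basis. (G b \<bullet> a) *\<^sub>R F a)"
      using that by (simp add: linear_sum linear_scale)
    finally show ?thesis by (simp add: inner_sum_left)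
  qed
  have "endo_trace (\<lambda>v. P (Q v)) = (\<Sum>b\<in>Basis. \<Sum>a\<in>Basis. (Q b \<bullet> a) * (P a \<bullet> b))"
    by (simp add: endo_trace_def e[OF assms(1)])
  also have "\<dots> = (\<Sum>a\<in>Basis. \<Sum>b\<in>Basis. (P a \<bullet> b) * (Q b \<bullet> a))"
    by (subst sum.swap) (simp add: mult.commute)
  also have "\<dots> = endo_trace (\<lambda>v. Q (P v))"
    by (simp add: endo_trace_def e[OF assms(2)])
  finally show ?thesis .
qed

text \<open>The trace is defined with the inner product of the model space, while positivity is assumed for
\<open>B\<close>. In a \<open>B\<close>-orthogonal frame the trace is \<open>\<Sum>\<^sub>a B(e\<^sub>a, T e\<^sub>a) / B(e\<^sub>a, e\<^sub>a)\<close>.\<close>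

lemma endo_trace_nonneg:
  fixes B :: "'e::euclidean_space \<Rightarrow> 'e \<Rightarrow> real"
  assumes B: "inner_form B" and T: "linear T" and nn: "\<And>v. B v (T v) \<ge> 0"
  shows "endo_trace T \<ge> 0"
proof -
  have "\<exists>e. orthogonal_frame (UNIV :: real set) (\<lambda>_. B) e"
    by (rule smooth_orthogonal_frame) (auto intro: B smooth_on_const)
  then obtain e where e: "orthogonal_frame (UNIV :: real set) (\<lambda>_. B) e" by (rule exE)
  have pos: "\<And>a. a \<in> Basis \<Longrightarrow> B (e a 0) (e a 0) > 0"
    and r: "\<And>l. linear l \<Longrightarrow> riesz B l = (\<Sum>a\<in>Basis. (l (e a 0) / B (e a 0) (e a 0)) *\<^sub>R e a 0)"
    using e unfolding orthogonal_frame_def by blast+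
  define f where "f = (\<lambda>a. e a 0)"
  define c where "c = (\<lambda>a. inverse (B (f a) (f a)))"
  have c: "c a \<ge> 0" if "a \<in> Basis" for a using pos[OF that] by (simp add: c_def f_def)
  have rep: "v = (\<Sum>a\<in>Basis. (c a * B v (f a)) *\<^sub>R f a)" for v
    using r[OF inner_form_linear(2)[OF B, of v]] riesz_eqI[OF B, of v "B v"]
    by (simp add: f_def c_def divide_inverse mult.commute)
  have "T v = (\<Sum>a\<in>Basis. (c a * B v (f a)) *\<^sub>R T (f a))" for v
  proof -
    have "T v = T (\<Sum>a\<in>Basis. (c a * B v (f a)) *\<^sub>R f a)" using rep[of v] by (rule arg_cong)
    also have "\<dots> = (\<Sum>a\<in>Basis. (c a * B v (f a)) *\<^sub>R T (f a))"
      by (simp add: linear_sum[OF T] linear_scale[OF T])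
    finally show ?thesis .
  qed
  note Te = this
  have "endo_trace T = (\<Sum>b\<in>Basis. \<Sum>a\<in>Basis. c a * ((T (f a) \<bullet> b) * B b (f a)))"
    unfolding endo_trace_def by (intro sum.cong refl, subst Te) (simp add: inner_sum_left mult_ac)
  also have "\<dots> = (\<Sum>a\<in>Basis. c a * (\<Sum>b\<in>Basis. (T (f a) \<bullet> b) * B b (f a)))"
    by (subst sum.swap) (simp add: sum_distrib_left)
  also have "\<dots> = (\<Sum>a\<in>Basis. c a * B (f a) (T (f a)))"
  proof (intro sum.cong refl arg_cong[of _ _ "(*) _"])
    fix a
    have "B (T (f a)) (f a) = B (\<Sum>b\<in>Basis. (T (f a) \<bullet> b) *\<^sub>R b) (f a)"
      by (simp add: euclidean_representation)
    also have "\<dots> = (\<Sum>b\<in>Basis. (T (f a) \<bullet> b) * B b (f a))"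
      using inner_form_linear(1)[OF B]
      by (simp add: linear_sum[of "\<lambda>v. B v (f a)"] linear_scale[of "\<lambda>v. B v (f a)"])
    finally show "(\<Sum>b\<in>Basis. (T (f a) \<bullet> b) * B b (f a)) = B (f a) (T (f a))"
      using B by (simp add: inner_form_def)
  qed
  also have "\<dots> \<ge> 0" by (intro sum_nonneg mult_nonneg_nonneg c nn)
  finally show ?thesis .
qed

section \<open>Riemannian geometry in a chart and the Bochner formula\<close>

lemma linear_dd_family:
  assumes "open S" "x \<in> S" "\<And>y. y \<in> S \<Longrightarrow> linear (L y)" "\<And>z. smooth_on (\<lambda>y. L y z) S"
  shows "linear (\<lambda>z. dd (\<lambda>y. L y z) x v)"
proof
  fix z w r
  have "dd (\<lambda>y. L y (z + w)) x v = dd (\<lambda>y. L y z + L y w) x v"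
    by (rule dd_cong[OF assms(1,2)]) (simp add: linear_add[OF assms(3)])
  also have "\<dots> = dd (\<lambda>y. L y z) x v + dd (\<lambda>y. L y w) x v"
    by (rule dd_add[OF assms(4) assms(4) assms(2)])
  finally show "dd (\<lambda>y. L y (z + w)) x v = dd (\<lambda>y. L y z) x v + dd (\<lambda>y. L y w) x v" .
  have "dd (\<lambda>y. L y (r *\<^sub>R z)) x v = dd (\<lambda>y. r *\<^sub>R L y z) x v"
    by (rule dd_cong[OF assms(1,2)]) (simp add: linear_scale[OF assms(3)])
  also have "\<dots> = r *\<^sub>R dd (\<lambda>y. L y z) x v"
    by (rule dd_bounded_linear[OF bounded_linear_scaleR_right assms(4) assms(2)])
  finally show "dd (\<lambda>y. L y (r *\<^sub>R z)) x v = r *\<^sub>R dd (\<lambda>y. L y z) x v" .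
qed

definition gradient :: "('e::euclidean_space \<Rightarrow> 'e \<Rightarrow> 'e \<Rightarrow> real) \<Rightarrow> ('e \<Rightarrow> real) \<Rightarrow> 'e \<Rightarrow> 'e" where
  "gradient H f x = riesz (H x) (\<lambda>z. dd f x z)"

text \<open>The endomorphism \<open>v \<mapsto> \<nabla>\<^sub>v X\<close> of the tangent space at \<open>x\<close>.\<close>

definition covariant ::
  "('e::euclidean_space \<Rightarrow> 'e \<Rightarrow> 'e \<Rightarrow> real) \<Rightarrow> ('e \<Rightarrow> 'e) \<Rightarrow> 'e \<Rightarrow> 'e \<Rightarrow> 'e" where
  "covariant H X x v = dd X x v + christoffel H x v (X x)"

definition laplacian :: "('e::euclidean_space \<Rightarrow> 'e \<Rightarrow> 'e \<Rightarrow> real) \<Rightarrow> ('e \<Rightarrow> real) \<Rightarrow> 'e \<Rightarrow> real" where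
  "laplacian H f x = endo_trace (covariant H (gradient H f) x)"

definition grad_square :: "('e::euclidean_space \<Rightarrow> 'e \<Rightarrow> 'e \<Rightarrow> real) \<Rightarrow> ('e \<Rightarrow> real) \<Rightarrow> 'e \<Rightarrow> real" where
  "grad_square H f x = H x (gradient H f x) (gradient H f x)"

definition hessian ::
  "('e::euclidean_space \<Rightarrow> 'e \<Rightarrow> 'e \<Rightarrow> real) \<Rightarrow> ('e \<Rightarrow> real) \<Rightarrow> 'e \<Rightarrow> 'e \<Rightarrow> 'e \<Rightarrow> real" where
  "hessian H f x v w = dd (\<lambda>y. dd f y w) x v - dd f x (christoffel H x v w)"

definition ricci_coord ::
  "('e::euclidean_space \<Rightarrow> 'e \<Rightarrow> 'e \<Rightarrow> real) \<Rightarrow> 'e \<Rightarrow> 'e \<Rightarrow> 'e \<Rightarrow> real" where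
  "ricci_coord H x v w = endo_trace (\<lambda>a. riemann_curvature H x a v w)"

locale local_metric =
  fixes S :: "'e::euclidean_space set" and H :: "'e \<Rightarrow> 'e \<Rightarrow> 'e \<Rightarrow> real"
  assumes open_S: "open S"
    and inner: "\<And>x. x \<in> S \<Longrightarrow> inner_form (H x)"
    and smooth_H: "\<And>v w. smooth_on (\<lambda>x. H x v w) S"
begin

lemma bilinear_H: "x \<in> S \<Longrightarrow> bilinear (H x)"
  and sym_H: "x \<in> S \<Longrightarrow> H x v w = H x w v"
  using inner by (auto simp: inner_form_def)

lemma H_add_left: "x \<in> S \<Longrightarrow> H x (v + v') w = H x v w + H x v' w"
  and H_add_right: "x \<in> S \<Longrightarrow> H x v (w + w') = H x v w + H x v w'"
  and H_scale_left: "x \<in> S \<Longrightarrow> H x (r *\<^sub>R v) w = r * H x v w"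
  and H_scale_right: "x \<in> S \<Longrightarrow> H x v (r *\<^sub>R w) = r * H x v w"
  using bilinear_H by (simp_all add: bilinear_ladd bilinear_radd bilinear_lmul bilinear_rmul)

lemma christoffel_eq_riesz:
  "christoffel G x v w = riesz (G x) (\<lambda>z. (dd (\<lambda>x. G x w z) x v + dd (\<lambda>x. G x v z) x w
      - dd (\<lambda>x. G x v w) x z) / 2)"
  by (simp add: christoffel_def riesz_def)

lemma linear_dd_H:
  assumes "x \<in> S"
  shows "linear (\<lambda>z. dd (\<lambda>y. H y z w) x v)" "linear (\<lambda>z. dd (\<lambda>y. H y w z) x v)"
  by (rule linear_dd_family[OF open_S assms inner_form_linear(1)[OF inner] smooth_H]; assumption)
     (rule linear_dd_family[OF open_S assms inner_form_linear(2)[OF inner] smooth_H]; assumption)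

lemma linear_koszul:
  assumes "x \<in> S"
  shows "linear (\<lambda>z. (dd (\<lambda>x. H x w z) x v + dd (\<lambda>x. H x v z) x w - dd (\<lambda>x. H x v w) x z) / 2)"
proof
  show "(dd (\<lambda>x. H x w (a + b)) x v + dd (\<lambda>x. H x v (a + b)) x w - dd (\<lambda>x. H x v w) x (a + b)) / 2 =
    (dd (\<lambda>x. H x w a) x v + dd (\<lambda>x. H x v a) x w - dd (\<lambda>x. H x v w) x a) / 2 +
    (dd (\<lambda>x. H x w b) x v + dd (\<lambda>x. H x v b) x w - dd (\<lambda>x. H x v w) x b) / 2" for a b
    using linear_add[OF linear_dd_H(2)[OF assms]] linear_add[OF smooth_on_linear_dd[OF smooth_H assms]]
    by (simp add: field_simps)
  show "(dd (\<lambda>x. H x w (r *\<^sub>R b)) x v + dd (\<lambda>x. H x v (r *\<^sub>R b)) x w - dd (\<lambda>x. H x v w) x (r *\<^sub>R b)) / 2 =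
    r *\<^sub>R ((dd (\<lambda>x. H x w b) x v + dd (\<lambda>x. H x v b) x w - dd (\<lambda>x. H x v w) x b) / 2)" for r b
    using linear_scale[OF linear_dd_H(2)[OF assms]] linear_scale[OF smooth_on_linear_dd[OF smooth_H assms]]
    by (simp add: field_simps)
qed

text \<open>The Koszul formula, now with the knowledge that the defining condition of \<open>christoffel\<close> has a
solution.\<close>

lemma koszul:
  assumes "x \<in> S"
  shows "H x (christoffel H x v w) z =
    (dd (\<lambda>x. H x w z) x v + dd (\<lambda>x. H x v z) x w - dd (\<lambda>x. H x v w) x z) / 2"
  unfolding christoffel_eq_riesz by (rule riesz_works[OF inner[OF assms] linear_koszul[OF assms]])

lemma smooth_on_christoffel: "smooth_on (\<lambda>x. christoffel H x v w) S"
proof -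
  have "smooth_on (\<lambda>x. (1/2) * (dd (\<lambda>x. H x w z) x v + dd (\<lambda>x. H x v z) x w - dd (\<lambda>x. H x v w) x z)) S" for z
    by (intro smooth_on_mult smooth_on_const smooth_on_diff smooth_on_add smooth_on_dd smooth_H open_S)
  then have sm: "smooth_on (\<lambda>x. (dd (\<lambda>x. H x w z) x v + dd (\<lambda>x. H x v z) x w - dd (\<lambda>x. H x v w) x z) / 2) S" for z
    by simp
  show ?thesis
    unfolding christoffel_eq_riesz
    by (rule smooth_on_riesz[OF open_S inner smooth_H linear_koszul sm])
qed

lemma christoffel_sym:
  assumes "x \<in> S"
  shows "christoffel H x v w = christoffel H x w v"
proof (rule inner_form_eqI[OF inner[OF assms]])
  fix z
  have "dd (\<lambda>x. H x v w) x z = dd (\<lambda>x. H x w v) x z"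
    by (rule dd_cong[OF open_S assms]) (rule sym_H)
  then show "H x (christoffel H x v w) z = H x (christoffel H x w v) z"
    by (simp add: koszul[OF assms])
qed

lemma linear_christoffel_right:
  assumes "x \<in> S"
  shows "linear (christoffel H x v)"
proof
  note li = linear_dd_H[OF assms] smooth_on_linear_dd[OF smooth_H assms]
  fix w w' r
  show "christoffel H x v (w + w') = christoffel H x v w + christoffel H x v w'"
    by (rule inner_form_eqI[OF inner[OF assms]])
      (simp add: H_add_left[OF assms] koszul[OF assms] linear_add[OF li(1)] linear_add[OF li(2)]
        linear_add[OF li(3)] field_simps)
  show "christoffel H x v (r *\<^sub>R w) = r *\<^sub>R christoffel H x v w"
    by (rule inner_form_eqI[OF inner[OF assms]])
      (simp add: H_scale_left[OF assms] koszul[OF assms] linear_scale[OF li(1)] linear_scale[OF li(2)]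
        linear_scale[OF li(3)] field_simps)
qed

lemma bilinear_christoffel:
  assumes "x \<in> S"
  shows "bilinear (christoffel H x)"
  using linear_christoffel_right[OF assms] christoffel_sym[OF assms]
  by (simp add: bilinear_def)

text \<open>The Levi-Civita connection preserves the metric: add the Koszul formulas for the two terms on the
right; all derivatives of \<open>H\<close> but one cancel.\<close>

lemma metric_compatible:
  assumes "x \<in> S"
  shows "dd (\<lambda>x. H x v w) x z = H x (christoffel H x z v) w + H x v (christoffel H x z w)"
proof -
  have s: "dd (\<lambda>x. H x a b) x c = dd (\<lambda>x. H x b a) x c" for a b c
    by (rule dd_cong[OF open_S assms]) (rule sym_H)
  show ?thesis
    using koszul[OF assms, of z v w] koszul[OF assms, of z w v] s[of v w z] s[of z w v] s[of z v w]
      sym_H[OF assms, of v "christoffel H x z w"] by argo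
qed

end

text \<open>A metric and a function in a chart. The abbreviations \<open>X\<close> and \<open>A\<close> introduced below stand for the
gradient and for the Hessian as an endomorphism.\<close>

locale local_metric_function = local_metric S H
  for S :: "'e::euclidean_space set" and H +
  fixes U :: "'e \<Rightarrow> real"
  assumes smooth_U: "smooth_on U S"
begin

abbreviation "\<Gamma> \<equiv> christoffel H"
abbreviation "X \<equiv> gradient H U"
abbreviation "A \<equiv> covariant H X"

lemma gradient_works:
  assumes "x \<in> S"
  shows "H x (X x) z = dd U x z"
  unfolding gradient_def using riesz_works[OF inner[OF assms] smooth_on_linear_dd[OF smooth_U assms]] .

lemma smooth_on_gradient: "smooth_on X S"
proof -
  have "smooth_on (\<lambda>x. riesz (H x) (frechet_derivative U (at x))) S"
    by (rule smooth_on_riesz[OF open_S inner smooth_H smooth_on_linear_dd[OF smooth_U] smooth_on_dd[OF smooth_U]])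
  then show ?thesis by (simp add: gradient_def[abs_def])
qed

lemma linear_covariant:
  assumes "x \<in> S"
  shows "linear (A x)"
  unfolding covariant_def
  using bilinear_christoffel[OF assms] smooth_on_linear_dd[OF smooth_on_gradient assms]
  by (intro linear_compose_add) (auto simp: bilinear_def)

lemma smooth_on_covariant: "smooth_on (\<lambda>x. A x v) S"
  unfolding covariant_def
  by (intro smooth_on_add open_S smooth_on_dd smooth_on_gradient
      smooth_on_linear_family(1)[OF open_S linear_christoffel_right smooth_on_christoffel smooth_on_gradient])

text \<open>Differentiate the defining equation \<open>H(X, w) = dU(w)\<close> of the gradient and replace the derivative of
\<open>H\<close> by Christoffel symbols.\<close>

lemma covariant_gradient_hessian:
  assumes "x \<in> S"
  shows "H x (A x v) w = hessian H U x v w"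
proof -
  have "dd (\<lambda>y. H y (X y) w) x v = dd (\<lambda>y. H y (X x) w) x v + H x (dd X x v) w"
    using smooth_on_linear_family(2)[OF open_S inner_form_linear(1)[OF inner] smooth_H
        smooth_on_gradient assms] by auto
  moreover have "dd (\<lambda>y. H y (X y) w) x v = dd (\<lambda>y. dd U y w) x v"
    by (rule dd_cong[OF open_S assms]) (rule gradient_works)
  ultimately show ?thesis
    using metric_compatible[OF assms, of "X x" w v] gradient_works[OF assms, of "\<Gamma> x v w"]
    by (simp add: hessian_def covariant_def H_add_left[OF assms])
qed

lemma hessian_sym:
  assumes "x \<in> S"
  shows "hessian H U x v w = hessian H U x w v"
  unfolding hessian_def using dd_commute[OF smooth_U open_S assms] christoffel_sym[OF assms] by simp

text \<open>This is the symmetry of the Hessian, that is, of second derivatives and of the connection.\<close>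

lemma covariant_gradient_self_adjoint:
  assumes "x \<in> S"
  shows "H x (A x v) w = H x v (A x w)"
  using covariant_gradient_hessian[OF assms] hessian_sym[OF assms] sym_H[OF assms] by metis

lemma smooth_on_grad_square: "smooth_on (grad_square H U) S"
proof -
  have "smooth_on (\<lambda>x. H x (X x) (X x)) S"
    by (rule smooth_on_bilinear_family(1)[OF open_S bilinear_H smooth_H smooth_on_gradient smooth_on_gradient])
  then show ?thesis by (simp add: grad_square_def[abs_def])
qed

text \<open>In other words \<open>A X\<close> is half the gradient of \<open>|X|\<^sup>2\<close>; here the self-adjointness of \<open>A\<close> enters. The
vector field \<open>A X\<close> is the one to which the second derivative test will be applied.\<close>

lemma dd_grad_square:
  assumes "x \<in> S"
  shows "dd (grad_square H U) x v = 2 * H x (A x (X x)) v"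
proof -
  have "dd (grad_square H U) x v =
      dd (\<lambda>y. H y (X x) (X x)) x v + H x (dd X x v) (X x) + H x (X x) (dd X x v)"
    unfolding grad_square_def[abs_def]
    by (rule smooth_on_bilinear_family(2)[OF open_S bilinear_H smooth_H smooth_on_gradient smooth_on_gradient assms])
  also have "\<dots> = 2 * H x (A x v) (X x)"
    using metric_compatible[OF assms, of "X x" "X x" v] sym_H[OF assms, of "X x"]
    by (simp add: covariant_def H_add_left[OF assms])
  also have "\<dots> = 2 * H x (A x (X x)) v"
    using covariant_gradient_self_adjoint[OF assms, of v "X x"] sym_H[OF assms, of v] by simp
  finally show ?thesis .
qed

lemma smooth_on_laplacian: "smooth_on (laplacian H U) S"
proof -
  have "smooth_on (\<lambda>x. \<Sum>b\<in>Basis. A x b \<bullet> b) S"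
    by (intro smooth_on_sum smooth_on_inner smooth_on_covariant smooth_on_const open_S)
  then show ?thesis by (simp add: laplacian_def[abs_def] endo_trace_def)
qed

lemma smooth_on_covariant_along_gradient: "smooth_on (\<lambda>x. A x (X x)) S"
  by (rule smooth_on_linear_family(1)[OF open_S linear_covariant smooth_on_covariant smooth_on_gradient])

lemma dd_covariant:
  assumes "x \<in> S"
  shows "dd (\<lambda>y. A y v) x b = dd (\<lambda>y. dd X y v) x b + dd (\<lambda>y. \<Gamma> y v (X x)) x b + \<Gamma> x v (dd X x b)"
proof -
  have "dd (\<lambda>y. A y v) x b = dd (\<lambda>y. dd X y v) x b + dd (\<lambda>y. \<Gamma> y v (X y)) x b"
    unfolding covariant_def
    by (rule dd_add[OF smooth_on_dd[OF smooth_on_gradient]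
          smooth_on_linear_family(1)[OF open_S linear_christoffel_right smooth_on_christoffel
            smooth_on_gradient] assms])
  then show ?thesis
    using smooth_on_linear_family(2)[OF open_S linear_christoffel_right smooth_on_christoffel
            smooth_on_gradient assms] by (simp add: add.assoc)
qed

text \<open>The Bochner formula \<open>\<langle>\<nabla>\<Delta>u, \<nabla>u\<rangle> + Rc(\<nabla>u, \<nabla>u) = \<Delta>(\<phi>/2) - |\<nabla>\<^sup>2u|\<^sup>2\<close> in index-free form: by
\<open>dd_grad_square\<close> the divergence of the field \<open>A X\<close> is the Laplacian of half the squared gradient,
and the trace of \<open>A\<^sup>2\<close> is the squared norm of the Hessian. When both sides are written as traces,
the summands differ by the commutator of \<open>A\<close> with the Christoffel endomorphism
\<open>\<Gamma>(X, \<cdot>)\<close>, whose trace vanishes.\<close>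

lemma bochner:
  assumes x: "x \<in> S"
  shows "dd (laplacian H U) x (X x) + ricci_coord H x (X x) (X x) =
    endo_trace (covariant H (\<lambda>y. A y (X y)) x) - endo_trace (\<lambda>v. A x (A x v))"
proof -
  let ?\<xi> = "X x"
  note G = linear_christoffel_right[OF x]
  note A = linear_covariant[OF x]
  have "dd (laplacian H U) x ?\<xi> = (\<Sum>b\<in>Basis. dd (\<lambda>y. A y b \<bullet> b) x ?\<xi>)"
    unfolding laplacian_def[abs_def] endo_trace_def
    by (rule dd_sum[OF _ x]) (intro smooth_on_inner smooth_on_covariant smooth_on_const open_S)
  also have "\<dots> = endo_trace (\<lambda>b. dd (\<lambda>y. A y b) x ?\<xi>)"
    unfolding endo_trace_def using dd_bounded_linear[OF bounded_linear_inner_left smooth_on_covariant x] by simp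
  finally have "dd (laplacian H U) x ?\<xi> + ricci_coord H x ?\<xi> ?\<xi> =
      endo_trace (\<lambda>b. dd (\<lambda>y. A y b) x ?\<xi> + riemann_curvature H x b ?\<xi> ?\<xi>)"
    by (simp add: ricci_coord_def endo_trace_add)
  also have "\<dots> = endo_trace (\<lambda>b. covariant H (\<lambda>y. A y (X y)) x b - A x (A x b)
      - (\<Gamma> x ?\<xi> (A x b) - A x (\<Gamma> x ?\<xi> b)))"
  proof (rule arg_cong[of _ _ endo_trace], rule ext)
    fix b
    have "dd (\<lambda>y. A y (X y)) x b = dd (\<lambda>y. A y ?\<xi>) x b + A x (dd X x b)"
      by (rule smooth_on_linear_family(2)[OF open_S linear_covariant smooth_on_covariant smooth_on_gradient x])
    moreover have "dd (\<lambda>y. dd X y b) x ?\<xi> = dd (\<lambda>y. dd X y ?\<xi>) x b"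
      by (rule dd_commute[OF smooth_on_gradient open_S x])
    moreover have "A x (A x b) = A x (dd X x b) + A x (\<Gamma> x ?\<xi> b)"
      using linear_add[OF A] christoffel_sym[OF x, of b] by (simp add: covariant_def[of H X x b])
    moreover have "\<Gamma> x ?\<xi> (A x b) = \<Gamma> x ?\<xi> (dd X x b) + \<Gamma> x ?\<xi> (\<Gamma> x b ?\<xi>)"
      using linear_add[OF G] by (simp add: covariant_def)
    moreover have "\<Gamma> x b (A x ?\<xi>) = \<Gamma> x b (dd X x ?\<xi>) + \<Gamma> x b (\<Gamma> x ?\<xi> ?\<xi>)"
      using linear_add[OF G] by (simp add: covariant_def)
    ultimately show "dd (\<lambda>y. A y b) x ?\<xi> + riemann_curvature H x b ?\<xi> ?\<xi> =
        covariant H (\<lambda>y. A y (X y)) x b - A x (A x b) - (\<Gamma> x ?\<xi> (A x b) - A x (\<Gamma> x ?\<xi> b))"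
      by (simp add: dd_covariant[OF x] riemann_curvature_def covariant_def[of H "\<lambda>y. A y (X y)"])
  qed
  also have "\<dots> = endo_trace (covariant H (\<lambda>y. A y (X y)) x) - endo_trace (\<lambda>v. A x (A x v))"
    using endo_trace_commute[OF G A, of ?\<xi>] by (simp add: endo_trace_diff)
  finally show ?thesis .
qed

text \<open>At a maximum of the squared gradient its differential vanishes, hence \<open>A X = 0\<close>, and the second
derivative test makes the derivative of the field \<open>A X\<close> negative semidefinite for \<open>H\<close>. Its trace is
then \<open>\<le> 0\<close>, and the trace of \<open>A\<^sup>2\<close> is \<open>\<ge> 0\<close> by self-adjointness.\<close>

lemma bochner_at_max:
  assumes x: "x \<in> S" and max: "\<And>y. y \<in> S \<Longrightarrow> grad_square H U y \<le> grad_square H U x"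
  shows "A x (X x) = 0"
    and "dd (laplacian H U) x (X x) + ricci_coord H x (X x) (X x) \<le> 0"
proof -
  let ?Y = "\<lambda>y. A y (X y)"
  have "H x (?Y x) z = H x 0 z" for z
    using second_derivative_test(1)[OF smooth_on_grad_square open_S x max] dd_grad_square[OF x, of z]
      linear_0[OF inner_form_linear(1)[OF inner[OF x]]] by simp
  then show Y0: "?Y x = 0" by (rule inner_form_eqI[OF inner[OF x]])
  have neg: "H x v (dd ?Y x v) \<le> 0" for v
  proof -
    have "dd (\<lambda>y. H y (?Y y) v) x v = dd (\<lambda>y. H y (?Y x) v) x v + H x (dd ?Y x v) v"
      using smooth_on_linear_family(2)[OF open_S inner_form_linear(1)[OF inner] smooth_H
        smooth_on_covariant_along_gradient x] by auto
    also have "dd (\<lambda>y. H y (?Y x) v) x v = 0"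
      using linear_0[OF linear_dd_H(1)[OF x]] Y0 by simp
    finally have "dd (\<lambda>y. H y (?Y y) v) x v = H x v (dd ?Y x v)" using sym_H[OF x] by simp
    moreover have "dd (\<lambda>y. dd (grad_square H U) y v) x v = dd (\<lambda>y. 2 * H y (?Y y) v) x v"
      by (rule dd_cong[OF open_S x]) (rule dd_grad_square)
    moreover have "smooth_on (\<lambda>y. H y (?Y y) v) S"
      by (rule smooth_on_linear_family(1)[OF open_S inner_form_linear(1)[OF inner] smooth_H
        smooth_on_covariant_along_gradient])
    then have "dd (\<lambda>y. 2 * H y (?Y y) v) x v = 2 * dd (\<lambda>y. H y (?Y y) v) x v"
      by (rule dd_bounded_linear[OF bounded_linear_mult_right _ x])
    ultimately show ?thesis
      using second_derivative_test(2)[OF smooth_on_grad_square open_S x max, of v] by simp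
  qed
  have "covariant H ?Y x v = dd ?Y x v" for v
    using linear_0[OF linear_christoffel_right[OF x]] Y0 by (simp add: covariant_def)
  moreover have "endo_trace (\<lambda>v. - dd ?Y x v) \<ge> 0"
  proof (rule endo_trace_nonneg[OF inner[OF x]])
    show "linear (\<lambda>v. - dd ?Y x v)"
      by (rule linear_compose_neg[OF smooth_on_linear_dd[OF smooth_on_covariant_along_gradient x]])
    show "0 \<le> H x v (- dd ?Y x v)" for v
      using neg[of v] linear_neg[OF inner_form_linear(2)[OF inner[OF x]]] by simp
  qed
  moreover have "endo_trace (\<lambda>v. A x (A x v)) \<ge> 0"
  proof (rule endo_trace_nonneg[OF inner[OF x]])
    show "linear (\<lambda>v. A x (A x v))"
      using linear_compose[OF linear_covariant[OF x] linear_covariant[OF x]] by (simp add: o_def)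
    show "0 \<le> H x v (A x (A x v))" for v
    proof -
      have "H x v (A x (A x v)) = H x (A x v) (A x v)"
        using covariant_gradient_self_adjoint[OF x, of v "A x v"] by simp
      then show ?thesis
        using inner[OF x] linear_0[OF inner_form_linear(1)[OF inner[OF x]]]
        unfolding inner_form_def by (metis less_eq_real_def)
    qed
  qed
  ultimately show "dd (laplacian H U) x (X x) + ricci_coord H x (X x) (X x) \<le> 0"
    using bochner[OF x] by (simp add: endo_trace_def sum_negf)
qed

end

section \<open>Ricci curvature of a warped product with a line\<close>

lemma smooth_on_Pair:
  assumes "open S" "smooth_on f S" "smooth_on g S"
  shows "smooth_on (\<lambda>x. (f x, g x)) S"
proof -
  have "smooth_on (\<lambda>x. (f x, 0) + (0, g x)) S"
    by (intro smooth_on_add assms smooth_on_bounded_linear_compose[OF bounded_linear_inj1]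
        smooth_on_bounded_linear_compose[OF bounded_linear_inj2])
  then show ?thesis by simp
qed

lemma dd_Pair:
  assumes "smooth_on f S" "smooth_on g S" "x \<in> S"
  shows "dd (\<lambda>x. (f x, g x)) x v = (dd f x v, dd g x v)"
  using dd_eqI[OF has_derivative_Pair[OF smooth_on_has_derivative[OF assms(1,3)]
    smooth_on_has_derivative[OF assms(2,3)]]] .

lemma endo_trace_prod_real:
  fixes T :: "'e::euclidean_space \<times> real \<Rightarrow> 'e \<times> real"
  shows "endo_trace T = endo_trace (\<lambda>b. fst (T (b, 0))) + snd (T (0, 1))"
proof -
  have "endo_trace T = (\<Sum>b\<in>(\<lambda>u. (u, 0)) ` Basis. T b \<bullet> b) + (\<Sum>b\<in>(\<lambda>v. (0, v)) ` Basis. T b \<bullet> b)"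
    unfolding endo_trace_def Basis_prod_def by (rule sum.union_disjoint) auto
  also have "(\<Sum>b\<in>(\<lambda>u. (u, 0)) ` Basis. T b \<bullet> b) = endo_trace (\<lambda>b. fst (T (b, 0)))"
    unfolding endo_trace_def by (subst sum.reindex) (auto simp: inj_on_def inner_prod_def)
  also have "(\<Sum>b\<in>(\<lambda>v. (0, v)) ` Basis. T b \<bullet> b) = snd (T (0, 1))"
    by (subst sum.reindex) (auto simp: inj_on_def inner_prod_def)
  finally show ?thesis .
qed

definition warped_coord ::
  "('e::euclidean_space \<Rightarrow> 'e \<Rightarrow> 'e \<Rightarrow> real) \<Rightarrow> ('e \<Rightarrow> real) \<Rightarrow>
   'e \<times> real \<Rightarrow> 'e \<times> real \<Rightarrow> 'e \<times> real \<Rightarrow> real" where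
  "warped_coord H U q v w = H (fst q) (fst v) (fst w) + exp (2 * U (fst q)) * (snd v * snd w)"

context local_metric_function
begin

abbreviation "G \<equiv> warped_coord H U"

lemma inner_form_warped:
  assumes "x \<in> S"
  shows "inner_form (G (x, s))"
proof -
  have "bilinear (G (x, s))"
    unfolding bilinear_def
    by (auto intro!: linearI simp: warped_coord_def H_add_left H_add_right H_scale_left H_scale_right
        assms algebra_simps)
  moreover have "G (x, s) v v > 0" if "v \<noteq> 0" for v
  proof (cases "fst v = 0")
    case True
    then have "snd v \<noteq> 0" using that by (simp add: prod_eq_iff)
    moreover have "H x 0 0 = 0" using H_scale_left[OF assms, of 0 0 0] by simp
    ultimately show ?thesis using True by (simp add: warped_coord_def zero_less_mult_iff not_square_less_zero)
        (metis linorder_neqE_linordered_idom)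
  next
    case False
    then have "H x (fst v) (fst v) > 0" using inner[OF assms] by (auto simp: inner_form_def)
    then show ?thesis by (simp add: warped_coord_def add_pos_nonneg)
  qed
  ultimately show ?thesis using sym_H[OF assms] by (auto simp: inner_form_def warped_coord_def mult.commute)
qed

lemma smooth_on_exp_2U: "smooth_on (\<lambda>y. exp (2 * U y)) S"
  by (intro smooth_on_exp smooth_on_mult smooth_on_const smooth_U open_S)

lemma dd_exp_2U:
  assumes "x \<in> S"
  shows "dd (\<lambda>y. exp (2 * U y)) x v = 2 * exp (2 * U x) * dd U x v"
  using dd_exp[OF smooth_on_mult[OF open_S smooth_on_const smooth_U] assms, of 2 v]
    dd_bounded_linear[OF bounded_linear_mult_right smooth_U assms, of 2 v] by simp

text \<open>Neither the metric nor anything derived from it depends on the coordinate of the line, so a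
derivative in the product is a derivative in \<open>S\<close> in the direction of the first component.\<close>

lemma dd_warped:
  assumes "x \<in> S"
  shows "dd (\<lambda>q. G q v w) (x, s) a =
    dd (\<lambda>y. H y (fst v) (fst w)) x (fst a) + 2 * exp (2 * U x) * dd U x (fst a) * (snd v * snd w)"
proof -
  let ?F = "\<lambda>y. H y (fst v) (fst w) + exp (2 * U y) * (snd v * snd w)"
  have s: "smooth_on (\<lambda>y. exp (2 * U y) * (snd v * snd w)) S"
    by (intro smooth_on_mult smooth_on_exp_2U smooth_on_const open_S)
  have "dd (\<lambda>q. G q v w) (x, s) a = dd ?F x (fst a)"
    unfolding warped_coord_def
    by (rule dd_fst[OF smooth_on_add[OF open_S smooth_H s] assms])
  then show ?thesis
    using dd_add[OF smooth_H s assms] dd_exp_2U[OF assms]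
      dd_bounded_linear[OF bounded_linear_mult_left smooth_on_exp_2U assms] by simp
qed

text \<open>The right-hand side solves the Koszul formula of the warped metric, and the solution is unique.\<close>

lemma christoffel_warped:
  assumes "x \<in> S"
  shows "christoffel G (x, s) v w =
    (\<Gamma> x (fst v) (fst w) - (snd v * snd w * exp (2 * U x)) *\<^sub>R X x,
     snd v * dd U x (fst w) + snd w * dd U x (fst v))"
  unfolding christoffel_eq_riesz[of G]
proof (rule riesz_eqI[OF inner_form_warped[OF assms]])
  fix z :: "'e \<times> real"
  have "H x (\<Gamma> x (fst v) (fst w) - (snd v * snd w * exp (2 * U x)) *\<^sub>R X x) (fst z) =
      H x (\<Gamma> x (fst v) (fst w)) (fst z) - snd v * snd w * exp (2 * U x) * dd U x (fst z)"
    using linear_diff[OF inner_form_linear(1)[OF inner[OF assms]]] H_scale_left[OF assms]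
      gradient_works[OF assms] by simp
  then have "G (x, s) (\<Gamma> x (fst v) (fst w) - (snd v * snd w * exp (2 * U x)) *\<^sub>R X x,
      snd v * dd U x (fst w) + snd w * dd U x (fst v)) z =
    H x (\<Gamma> x (fst v) (fst w)) (fst z) - snd v * snd w * exp (2 * U x) * dd U x (fst z)
    + exp (2 * U x) * ((snd v * dd U x (fst w) + snd w * dd U x (fst v)) * snd z)"
    by (simp add: warped_coord_def)
  then show "G (x, s) (\<Gamma> x (fst v) (fst w) - (snd v * snd w * exp (2 * U x)) *\<^sub>R X x,
      snd v * dd U x (fst w) + snd w * dd U x (fst v)) z =
    (dd (\<lambda>q. G q w z) (x, s) v + dd (\<lambda>q. G q v z) (x, s) w - dd (\<lambda>q. G q v w) (x, s) z) / 2"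
    unfolding dd_warped[OF assms] koszul[OF assms] by (simp add: field_simps)
qed

lemma dd_christoffel_warped:
  assumes "x \<in> S"
  shows "dd (\<lambda>q. christoffel G q v w) (x, s) a =
    (dd (\<lambda>y. \<Gamma> y (fst v) (fst w)) x (fst a)
      - (snd v * snd w * exp (2 * U x)) *\<^sub>R ((2 * dd U x (fst a)) *\<^sub>R X x + dd X x (fst a)),
     snd v * dd (\<lambda>y. dd U y (fst w)) x (fst a) + snd w * dd (\<lambda>y. dd U y (fst v)) x (fst a))"
proof -
  let ?c = "snd v * snd w"
  let ?e = "\<lambda>y. (?c * exp (2 * U y)) *\<^sub>R X y"
  let ?f = "\<lambda>y. \<Gamma> y (fst v) (fst w) + - ?e y"
  let ?g1 = "\<lambda>y. snd v * dd U y (fst w)" and ?g2 = "\<lambda>y. snd w * dd U y (fst v)"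
  have se1: "smooth_on (\<lambda>y. ?c * exp (2 * U y)) S"
    by (intro smooth_on_mult smooth_on_exp_2U smooth_on_const open_S)
  have se: "smooth_on ?e S"
    by (rule smooth_on_scaleR[OF open_S se1 smooth_on_gradient])
  have sf: "smooth_on ?f S"
    by (rule smooth_on_add[OF open_S smooth_on_christoffel smooth_on_minus[OF open_S se]])
  have sg1: "smooth_on ?g1 S" and sg2: "smooth_on ?g2 S"
    by (intro smooth_on_mult smooth_on_const smooth_on_dd smooth_U open_S)+
  have sg: "smooth_on (\<lambda>y. ?g1 y + ?g2 y) S"
    by (rule smooth_on_add[OF open_S sg1 sg2])
  have "dd (\<lambda>q. christoffel G q v w) (x, s) a = dd (\<lambda>q. (?f (fst q), ?g1 (fst q) + ?g2 (fst q))) (x, s) a"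
  proof (rule dd_cong[of "S \<times> UNIV"])
    show "christoffel G q v w = (?f (fst q), ?g1 (fst q) + ?g2 (fst q))" if "q \<in> S \<times> UNIV" for q
      using that christoffel_warped[of "fst q" "snd q" v w] by auto
  qed (use open_S assms in \<open>auto intro: open_Times\<close>)
  also have "\<dots> = dd (\<lambda>y. (?f y, ?g1 y + ?g2 y)) x (fst a)"
    by (rule dd_fst[OF smooth_on_Pair[OF open_S sf sg] assms])
  also have "\<dots> = (dd ?f x (fst a), dd (\<lambda>y. ?g1 y + ?g2 y) x (fst a))"
    by (rule dd_Pair[OF sf sg assms])
  also have "dd ?f x (fst a) = dd (\<lambda>y. \<Gamma> y (fst v) (fst w)) x (fst a) + - dd ?e x (fst a)"
    using dd_add[OF smooth_on_christoffel smooth_on_minus[OF open_S se] assms]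
      dd_bounded_linear[OF bounded_linear_minus[OF bounded_linear_ident] se assms] by simp
  also have "dd ?e x (fst a) = (?c * exp (2 * U x)) *\<^sub>R dd X x (fst a)
      + (?c * (2 * exp (2 * U x) * dd U x (fst a))) *\<^sub>R X x"
    using dd_bilinear[OF bounded_bilinear_scaleR se1 smooth_on_gradient assms]
      dd_bounded_linear[OF bounded_linear_mult_right smooth_on_exp_2U assms] dd_exp_2U[OF assms] by simp
  also have "dd (\<lambda>y. ?g1 y + ?g2 y) x (fst a) =
      snd v * dd (\<lambda>y. dd U y (fst w)) x (fst a) + snd w * dd (\<lambda>y. dd U y (fst v)) x (fst a)"
    using dd_add[OF sg1 sg2 assms]
      dd_bounded_linear[OF bounded_linear_mult_right smooth_on_dd[OF smooth_U] assms] by simp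
  finally show ?thesis by (simp add: algebra_simps)
qed

text \<open>Evaluating the curvature on purely horizontal or purely vertical vectors puts zeros into the
formulas above; these are the rules that remove the resulting terms.\<close>

lemma vanishing_arguments:
  assumes "x \<in> S"
  shows "\<Gamma> x 0 w = 0" "\<Gamma> x v 0 = 0" "dd U x 0 = 0" "dd X x 0 = 0"
    "dd (\<lambda>y. \<Gamma> y 0 w) x a = 0" "dd (\<lambda>y. \<Gamma> y v 0) x a = 0" "dd (\<lambda>y. dd U y 0) x a = 0"
    "dd (\<lambda>y. \<Gamma> y v w) x 0 = 0" "dd (\<lambda>y. dd U y v) x 0 = 0"
proof -
  have 1: "\<Gamma> y 0 w = 0" "\<Gamma> y v 0 = 0" "dd U y 0 = 0" if "y \<in> S" for y v w
    using linear_0[OF linear_christoffel_right[OF that]] christoffel_sym[OF that, of 0]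
      linear_0[OF smooth_on_linear_dd[OF smooth_U that]] by simp_all
  show "\<Gamma> x 0 w = 0" "\<Gamma> x v 0 = 0" "dd U x 0 = 0" using 1 assms by auto
  show "dd X x 0 = 0" "dd (\<lambda>y. \<Gamma> y v w) x 0 = 0" "dd (\<lambda>y. dd U y v) x 0 = 0"
    using linear_0[OF smooth_on_linear_dd[OF smooth_on_gradient assms]]
      linear_0[OF smooth_on_linear_dd[OF smooth_on_christoffel assms]]
      linear_0[OF smooth_on_linear_dd[OF smooth_on_dd[OF smooth_U] assms]] by auto
  show "dd (\<lambda>y. \<Gamma> y 0 w) x a = 0"
    using dd_cong[OF open_S assms, of "\<lambda>y. \<Gamma> y 0 w" "\<lambda>_. 0"] 1 by simp
  show "dd (\<lambda>y. \<Gamma> y v 0) x a = 0"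
    using dd_cong[OF open_S assms, of "\<lambda>y. \<Gamma> y v 0" "\<lambda>_. 0"] 1 by simp
  show "dd (\<lambda>y. dd U y 0) x a = 0"
    using dd_cong[OF open_S assms, of "\<lambda>y. dd U y 0" "\<lambda>_. 0"] 1 by simp
qed

lemma ricci_warped_horizontal:
  assumes "x \<in> S"
  shows "ricci_coord G (x, s) (v, 0) (w, 0) =
    ricci_coord H x v w - hessian H U x v w - dd U x v * dd U x w"
  unfolding ricci_coord_def endo_trace_prod_real
  by (simp add: riemann_curvature_def dd_christoffel_warped[OF assms] christoffel_warped[OF assms]
      vanishing_arguments[OF assms] hessian_def)

text \<open>The squared gradient arises as the trace of the rank one endomorphism \<open>b \<mapsto> dU(b) X\<close>. The vertical
direction adds nothing to the trace, as the curvature is antisymmetric in its first two arguments.\<close>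

lemma ricci_warped_vertical:
  assumes "x \<in> S"
  shows "ricci_coord G (x, s) (0, 1) (0, 1) = - exp (2 * U x) * (laplacian H U x + grad_square H U x)"
proof -
  have d: "\<Gamma> x b (- (r *\<^sub>R y)) = - (r *\<^sub>R \<Gamma> x b y)" for b r y
    using linear_neg[OF linear_christoffel_right[OF assms]] linear_scale[OF linear_christoffel_right[OF assms]]
    by simp
  \<comment> \<open>the horizontal component of \<open>R(b, \<partial>\<^sub>s)\<partial>\<^sub>s\<close>, of which the trace over \<open>b\<close> is taken below\<close>
  have riem: "fst (riemann_curvature G (x, s) (b, 0) (0, 1) (0, 1)) =
      (- exp (2 * U x)) *\<^sub>R (A x b + dd U x b *\<^sub>R X x)" for b
    by (simp add: riemann_curvature_def dd_christoffel_warped[OF assms] christoffel_warped[OF assms]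
      vanishing_arguments[OF assms] covariant_def d scaleR_add_right scaleR_add_left[symmetric] algebra_simps)
  moreover have "snd (riemann_curvature G (x, s) (0, 1) (0, 1) (0, 1)) = 0"
    by (simp add: riemann_curvature_def)
  moreover have "endo_trace (\<lambda>b. dd U x b *\<^sub>R X x) = grad_square H U x"
  proof -
    have "endo_trace (\<lambda>b. dd U x b *\<^sub>R X x) = (\<Sum>b\<in>Basis. (X x \<bullet> b) * dd U x b)"
      by (simp add: endo_trace_def mult.commute)
    also have "\<dots> = dd U x (\<Sum>b\<in>Basis. (X x \<bullet> b) *\<^sub>R b)"
      using smooth_on_linear_dd[OF smooth_U assms] by (simp add: linear_sum linear_scale)
    also have "\<dots> = grad_square H U x"
      using gradient_works[OF assms] by (simp add: euclidean_representation grad_square_def)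
    finally show ?thesis .
  qed
  ultimately show ?thesis
    unfolding ricci_coord_def endo_trace_prod_real riem endo_trace_scaleR endo_trace_add laplacian_def by simp
qed

end

section \<open>Evolution of the squared gradient in a chart\<close>

lemma smooth_on_real_derivative:
  fixes f :: "real \<Rightarrow> real"
  assumes "smooth_on f T" "t \<in> T"
  shows "(f has_real_derivative dd f t 1) (at t)"
proof -
  have "dd f t h = h * dd f t 1" for h
    using linear_scale[OF smooth_on_linear_dd[OF assms], of h 1] by simp
  then have "frechet_derivative f (at t) = (*) (dd f t 1)" by (intro ext) (metis mult.commute)
  then show ?thesis
    using smooth_on_has_derivative[OF assms] by (simp add: has_field_derivative_def)
qed

lemma has_real_derivative_dd:
  "(f has_real_derivative D) (at t) \<Longrightarrow> dd f t 1 = D"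
  using dd_eqI[of f "(*) D" t 1] by (simp add: has_field_derivative_def)

text \<open>The system of evolution equations for \<open>h\<close> and \<open>u\<close> that the Ricci flow on the warped product induces
on the base, in a chart.\<close>

locale local_flow =
  fixes S :: "'e::euclidean_space set" and h :: "real \<Rightarrow> 'e \<Rightarrow> 'e \<Rightarrow> 'e \<Rightarrow> real"
    and U :: "real \<Rightarrow> 'e \<Rightarrow> real"
  assumes open_S: "open S"
    and inner: "\<And>t x. t < 0 \<Longrightarrow> x \<in> S \<Longrightarrow> inner_form (h t x)"
    and smooth_h: "\<And>v w. smooth_on (\<lambda>(x, t). h t x v w) (S \<times> {..<0})"
    and smooth_U: "smooth_on (\<lambda>(x, t). U t x) (S \<times> {..<0})"
    and metric_flow: "\<And>t x v w. t < 0 \<Longrightarrow> x \<in> S \<Longrightarrow>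
      ((\<lambda>\<tau>. h \<tau> x v w) has_real_derivative
        - 2 * (ricci_coord (h t) x v w - hessian (h t) (U t) x v w - dd (U t) x v * dd (U t) x w)) (at t)"
    and function_flow: "\<And>t x. t < 0 \<Longrightarrow> x \<in> S \<Longrightarrow>
      ((\<lambda>\<tau>. U \<tau> x) has_real_derivative laplacian (h t) (U t) x + grad_square (h t) (U t) x) (at t)"
begin

lemma local_metric_function_at: "t < 0 \<Longrightarrow> local_metric_function S (h t) (U t)"
  using smooth_on_slice_fst(1)[OF smooth_h open_S open_lessThan, of t]
    smooth_on_slice_fst(1)[OF smooth_U open_S open_lessThan, of t] open_S inner
  by unfold_locales auto

lemma dd_space:
  "t < 0 \<Longrightarrow> x \<in> S \<Longrightarrow> dd (U t) x v = dd (\<lambda>(x, t). U t x) (x, t) (v, 0)"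
  using smooth_on_slice_fst(2)[OF smooth_U open_S open_lessThan, of t x v] by simp

lemma smooth_on_gradient_spacetime: "smooth_on (\<lambda>(x, t). gradient (h t) (U t) x) (S \<times> {..<0})"
proof -
  have op: "open (S \<times> {..<0::real})" by (intro open_Times open_S open_lessThan)
  have "smooth_on (\<lambda>q. riesz (h (snd q) (fst q)) (\<lambda>v. dd (U (snd q)) (fst q) v)) (S \<times> {..<0})"
  proof (rule smooth_on_riesz[OF op])
    show "inner_form (h (snd q) (fst q))" if "q \<in> S \<times> {..<0}" for q using that inner by auto
    show "smooth_on (\<lambda>q. h (snd q) (fst q) v w) (S \<times> {..<0})" for v w
      using smooth_h[of v w] by (simp add: case_prod_beta')
    show "linear (\<lambda>v. dd (U (snd q)) (fst q) v)" if "q \<in> S \<times> {..<0}" for q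
      using that local_metric_function.smooth_U[OF local_metric_function_at, of "snd q"]
      by (auto intro: smooth_on_linear_dd)
    show "smooth_on (\<lambda>q. dd (U (snd q)) (fst q) z) (S \<times> {..<0})" for z
      by (rule smooth_on_cong[OF smooth_on_dd[OF smooth_U, of "(z, 0)"] op]) (auto simp: dd_space)
  qed
  then show ?thesis by (simp add: gradient_def case_prod_beta')
qed

lemma smooth_on_grad_square_spacetime: "smooth_on (\<lambda>(x, t). grad_square (h t) (U t) x) (S \<times> {..<0})"
proof -
  have op: "open (S \<times> {..<0::real})" by (intro open_Times open_S open_lessThan)
  have "smooth_on (\<lambda>q. h (snd q) (fst q) (gradient (h (snd q)) (U (snd q)) (fst q))
      (gradient (h (snd q)) (U (snd q)) (fst q))) (S \<times> {..<0})"
  proof (rule smooth_on_bilinear_family(1)[OF op, where B = "\<lambda>q. h (snd q) (fst q)"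
        and a = "\<lambda>q. gradient (h (snd q)) (U (snd q)) (fst q)"])
    show "bilinear (h (snd q) (fst q))" if "q \<in> S \<times> {..<0}" for q
      using that inner[of "snd q" "fst q"] by (auto simp: inner_form_def)
    show "smooth_on (\<lambda>q. h (snd q) (fst q) v w) (S \<times> {..<0})" for v w
      using smooth_h[of v w] by (simp add: case_prod_beta')
  qed (use smooth_on_gradient_spacetime in \<open>simp_all add: case_prod_beta'\<close>)
  then show ?thesis by (simp add: grad_square_def case_prod_beta')
qed

text \<open>Exchange the derivatives in time and in space and insert \<open>\<partial>\<^sub>t u = \<Delta>u + |\<nabla>u|\<^sup>2\<close>.\<close>

lemma dd_time_dd_space:
  assumes t: "t < 0" and x: "x \<in> S"
  shows "dd (\<lambda>\<tau>. dd (U \<tau>) x v) t 1 =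
    dd (laplacian (h t) (U t)) x v + dd (grad_square (h t) (U t)) x v"
proof -
  interpret local_metric_function S "h t" "U t" by (rule local_metric_function_at[OF t])
  let ?U = "\<lambda>(x, t). U t x"
  have op: "open (S \<times> {..<0::real})" by (intro open_Times open_S open_lessThan)
  have q: "(x, t) \<in> S \<times> {..<0}" using t x by simp
  have ut: "dd ?U (y, t) (0, 1) = laplacian (h t) (U t) y + grad_square (h t) (U t) y" if "y \<in> S" for y
    using smooth_on_slice_snd(2)[OF local_flow.smooth_U[OF local_flow_axioms] open_S open_lessThan that, of t 1]
      has_real_derivative_dd[OF function_flow[OF t that]] t by simp
  have "dd (\<lambda>\<tau>. dd (U \<tau>) x v) t 1 = dd (\<lambda>\<tau>. dd ?U (x, \<tau>) (v, 0)) t 1"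
    by (rule dd_cong[of "{..<0}"]) (use t x dd_space in auto)
  also have "\<dots> = dd (\<lambda>q. dd ?U q (v, 0)) (x, t) (0, 1)"
    using smooth_on_slice_snd(2)[OF smooth_on_dd[OF local_flow.smooth_U[OF local_flow_axioms]] open_S open_lessThan x, of t]
      t by simp
  also have "\<dots> = dd (\<lambda>q. dd ?U q (0, 1)) (x, t) (v, 0)"
    by (rule dd_commute[OF local_flow.smooth_U[OF local_flow_axioms] op q])
  also have "\<dots> = dd (\<lambda>y. dd ?U (y, t) (0, 1)) x v"
    using smooth_on_slice_fst(2)[OF smooth_on_dd[OF local_flow.smooth_U[OF local_flow_axioms]] open_S open_lessThan, of t x]
      t x by simp
  also have "\<dots> = dd (\<lambda>y. laplacian (h t) (U t) y + grad_square (h t) (U t) y) x v"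
    by (rule dd_cong[OF open_S x]) (rule ut)
  also have "\<dots> = dd (laplacian (h t) (U t)) x v + dd (grad_square (h t) (U t)) x v"
    by (rule dd_add[OF smooth_on_laplacian smooth_on_grad_square x])
  finally show ?thesis .
qed

text \<open>With \<open>X = \<nabla>u\<close> one has \<open>\<partial>\<^sub>t |X|\<^sup>2 = 2 d(\<partial>\<^sub>t u)(X) - (\<partial>\<^sub>t h)(X, X)\<close>; the last term has a minus sign because
the squared length of a covector involves the inverse metric. When the evolution equations are
inserted, the terms with \<open>d|X|\<^sup>2\<close> and \<open>\<nabla>\<^sup>2u(X, X)\<close> vanish at the maximum, the Laplacian and the
Ricci curvature combine to the left-hand side of the Bochner formula, and \<open>du(X)\<^sup>2 = |X|\<^sup>4\<close> remains.\<close>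

lemma grad_square_decays_at_max:
  assumes t: "t < 0" and x: "x \<in> S"
    and max: "\<And>y. y \<in> S \<Longrightarrow> grad_square (h t) (U t) y \<le> grad_square (h t) (U t) x"
  obtains D where "((\<lambda>\<tau>. grad_square (h \<tau>) (U \<tau>) x) has_real_derivative D) (at t)"
    "D \<le> - 2 * (grad_square (h t) (U t) x)\<^sup>2"
proof -
  interpret local_metric_function S "h t" "U t" by (rule local_metric_function_at[OF t])
  define a where "a = (\<lambda>\<tau>. gradient (h \<tau>) (U \<tau>) x)"
  let ?\<phi> = "grad_square (h t) (U t) x"
  have T: "t \<in> {..<0}" using t by simp
  note slice = smooth_on_slice_snd(1)[OF _ open_S open_lessThan x]
  have sa: "smooth_on a {..<0}"
    using slice[OF smooth_on_gradient_spacetime] by (simp add: a_def)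
  have sk: "smooth_on (\<lambda>\<tau>. h \<tau> x v w) {..<0}" for v w
    using slice[OF smooth_h] by simp
  have sf: "smooth_on (\<lambda>\<tau>. grad_square (h \<tau>) (U \<tau>) x) {..<0}"
    using slice[OF smooth_on_grad_square_spacetime] by simp
  have inn: "inner_form (h \<tau> x)" if "\<tau> \<in> {..<0}" for \<tau>
    using that x local_flow.inner[OF local_flow_axioms] by simp
  have bil: "bilinear (h \<tau> x)" if "\<tau> \<in> {..<0}" for \<tau> using inn[OF that] by (simp add: inner_form_def)
  have grad: "h \<tau> x (a \<tau>) z = dd (U \<tau>) x z" if "\<tau> \<in> {..<0}" for \<tau> z
    using local_metric_function.gradient_works[OF local_metric_function_at, of \<tau> x z] that x
    by (simp add: a_def)
  \<comment> \<open>The derivative of \<open>h(a, a)\<close> involves \<open>h(\<partial>\<^sub>t a, a)\<close>, which the time derivative of the defining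
    equation \<open>h(a, z) = du(z)\<close> eliminates.\<close>
  have e1: "dd (\<lambda>\<tau>. grad_square (h \<tau>) (U \<tau>) x) t 1 =
      dd (\<lambda>\<tau>. h \<tau> x (a t) (a t)) t 1 + h t x (dd a t 1) (a t) + h t x (a t) (dd a t 1)"
    using smooth_on_bilinear_family(2)[OF open_lessThan bil sk sa sa T, where v = 1]
    by (simp add: grad_square_def a_def)
  have "dd (\<lambda>\<tau>. h \<tau> x (a \<tau>) (a t)) t 1 = dd (\<lambda>\<tau>. h \<tau> x (a t) (a t)) t 1 + h t x (dd a t 1) (a t)"
    by (rule smooth_on_linear_family(2)[OF open_lessThan inner_form_linear(1)[OF inn] sk sa T])
  moreover have "dd (\<lambda>\<tau>. h \<tau> x (a \<tau>) (a t)) t 1 = dd (\<lambda>\<tau>. dd (U \<tau>) x (a t)) t 1"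
    by (rule dd_cong[OF open_lessThan T]) (rule grad)
  moreover have "h t x (a t) (dd a t 1) = h t x (dd a t 1) (a t)" by (rule sym_H[OF x])
  ultimately have e2: "dd (\<lambda>\<tau>. grad_square (h \<tau>) (U \<tau>) x) t 1 =
      2 * dd (\<lambda>\<tau>. dd (U \<tau>) x (a t)) t 1 - dd (\<lambda>\<tau>. h \<tau> x (a t) (a t)) t 1"
    using e1 by simp
  have a: "a t = X x" by (simp add: a_def)
  have "dd (\<lambda>\<tau>. h \<tau> x (a t) (a t)) t 1 =
      - 2 * (ricci_coord (h t) x (X x) (X x) - hessian (h t) (U t) x (X x) (X x) - dd (U t) x (X x) * dd (U t) x (X x))"
    unfolding a by (rule has_real_derivative_dd[OF metric_flow[OF t x]])
  moreover have "hessian (h t) (U t) x (X x) (X x) = 0"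
    using covariant_gradient_hessian[OF x, of "X x" "X x"] bochner_at_max(1)[OF x max]
      linear_0[OF inner_form_linear(1)[OF inner[OF x]]] by simp
  moreover have "dd (U t) x (X x) = ?\<phi>"
    using gradient_works[OF x] by (simp add: grad_square_def)
  moreover have "dd (grad_square (h t) (U t)) x (X x) = 0"
    by (rule second_derivative_test(1)[OF smooth_on_grad_square open_S x max])
  ultimately have "dd (\<lambda>\<tau>. grad_square (h \<tau>) (U \<tau>) x) t 1 =
      2 * (dd (laplacian (h t) (U t)) x (X x) + ricci_coord (h t) x (X x) (X x)) - 2 * ?\<phi>\<^sup>2"
    using e2 dd_time_dd_space[OF t x, of "X x"] by (simp add: a power2_eq_square)
  then have "dd (\<lambda>\<tau>. grad_square (h \<tau>) (U \<tau>) x) t 1 \<le> - 2 * ?\<phi>\<^sup>2"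
    using bochner_at_max(2)[OF x max] by simp
  then show ?thesis using that smooth_on_real_derivative[OF sf T] by blast
qed

end

section \<open>From the manifold to its charts\<close>

lemma christoffel_cong:
  assumes "open T" "x \<in> T" "\<And>y. y \<in> T \<Longrightarrow> G y = G' y"
  shows "christoffel G x v w = christoffel G' x v w"
proof -
  have "dd (\<lambda>y. G y a b) x = dd (\<lambda>y. G' y a b) x" for a b
    by (rule frechet_derivative_local_cong[OF assms(1,2)]) (simp add: assms(3))
  then show ?thesis by (simp add: christoffel_def assms)
qed

lemma riemann_curvature_cong:
  assumes "open T" "x \<in> T" "\<And>y. y \<in> T \<Longrightarrow> G y = G' y"
  shows "riemann_curvature G x a v w = riemann_curvature G' x a v w"
proof -
  have c: "christoffel G y b d = christoffel G' y b d" if "y \<in> T" for y b d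
    by (rule christoffel_cong[OF assms(1) that assms(3)])
  have "dd (\<lambda>y. christoffel G y b d) x = dd (\<lambda>y. christoffel G' y b d) x" for b d
    by (rule frechet_derivative_local_cong[OF assms(1,2) c])
  then show ?thesis by (simp add: riemann_curvature_def c[OF assms(2)])
qed

lemma ricci_eq_ricci_coord: "ricci g c p v w = ricci_coord (local_rep c g) (coord c p) v w"
  by (simp add: ricci_def ricci_coord_def endo_trace_def)

lemma tensor2_field_change:
  assumes "tensor2_field N T" "c \<in> charts N" "c' \<in> charts N" "p \<in> chart_dom c" "p \<in> chart_dom c'"
  shows "T c p v w = T c' p (dd (transition c c') (coord c p) v) (dd (transition c c') (coord c p) w)"
proof -
  have "\<forall>c\<in>charts N. \<forall>c'\<in>charts N. \<forall>p\<in>chart_dom c \<inter> chart_dom c'. \<forall>v w.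
        T c p v w = T c' p (dd (transition c c') (coord c p) v) (dd (transition c c') (coord c p) w)"
    using assms(1)[unfolded tensor2_field_def] by (rule conjunct2)
  then show ?thesis using assms(2-5) by (meson IntI)
qed

locale manifold_atlas =
  fixes N :: "('a, 'e::euclidean_space) manifold"
  assumes smooth_manifold_N: "smooth_manifold N"
begin

lemma chart_homeomorphic:
  "c \<in> charts N \<Longrightarrow> homeomorphic_map (subtopology (topo N) (chart_dom c)) (top_of_set (img c)) (coord c)"
  and chart_open: "c \<in> charts N \<Longrightarrow> openin (topo N) (chart_dom c)"
  and img_open: "c \<in> charts N \<Longrightarrow> open (img c)"
  and charts_cover: "(\<Union>c\<in>charts N. chart_dom c) = topspace (topo N)"
  and transition_smooth: "c \<in> charts N \<Longrightarrow> c' \<in> charts N \<Longrightarrow>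
    smooth_on (transition c c') (coord c ` (chart_dom c \<inter> chart_dom c'))"
  using smooth_manifold_N by (auto simp: smooth_manifold_def)

lemma chart_topspace:
  assumes "c \<in> charts N"
  shows "topspace (subtopology (topo N) (chart_dom c)) = chart_dom c"
  using openin_subset[OF chart_open[OF assms]] by auto

lemma coord_inj: "c \<in> charts N \<Longrightarrow> inj_on (coord c) (chart_dom c)"
  using homeomorphic_imp_injective_map[OF chart_homeomorphic] chart_topspace by metis

lemma inv_coord_coord: "c \<in> charts N \<Longrightarrow> p \<in> chart_dom c \<Longrightarrow> inv_coord c (coord c p) = p"
  using coord_inj by (simp add: inv_coord_def)

lemma coord_in_img: "p \<in> chart_dom c \<Longrightarrow> coord c p \<in> img c"
  by (simp add: img_def)

lemma inv_coord_in_dom: "x \<in> img c \<Longrightarrow> inv_coord c x \<in> chart_dom c"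
  by (simp add: img_def inv_coord_def inv_into_into)

lemma coord_inv_coord: "x \<in> img c \<Longrightarrow> coord c (inv_coord c x) = x"
  by (simp add: img_def inv_coord_def f_inv_into_f)

lemma chart_overlap_open:
  assumes "c \<in> charts N" "c' \<in> charts N"
  shows "open (coord c ` (chart_dom c \<inter> chart_dom c'))"
proof -
  have "openin (subtopology (topo N) (chart_dom c)) (chart_dom c \<inter> chart_dom c')"
    using chart_open[OF assms(2)] by (metis inf_commute openin_subtopology)
  then have "openin (top_of_set (img c)) (coord c ` (chart_dom c \<inter> chart_dom c'))"
    using homeomorphic_imp_open_map[OF chart_homeomorphic[OF assms(1)]] by (auto simp: open_map_def)
  then show ?thesis using img_open[OF assms(1)] openin_open_trans by blast
qed

lemma chart_preimage_open:
  assumes "c \<in> charts N" "open V"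
  shows "openin (topo N) {p \<in> chart_dom c. coord c p \<in> V}"
proof -
  have "openin (top_of_set (img c)) (img c \<inter> V)" using assms(2) by (simp add: openin_open_Int)
  then have "openin (subtopology (topo N) (chart_dom c)) {p \<in> chart_dom c. coord c p \<in> img c \<inter> V}"
    using openin_continuous_map_preimage[OF homeomorphic_imp_continuous_map[OF chart_homeomorphic[OF assms(1)]]]
      chart_topspace[OF assms(1)] by metis
  then have "openin (topo N) {p \<in> chart_dom c. coord c p \<in> img c \<inter> V}"
    using openin_trans_full[OF _ chart_open[OF assms(1)]] by blast
  moreover have "{p \<in> chart_dom c. coord c p \<in> img c \<inter> V} = {p \<in> chart_dom c. coord c p \<in> V}"
    by (auto simp: img_def)
  ultimately show ?thesis by simp
qed

abbreviation line_chart :: "('a, 'e) chart \<Rightarrow> ('a \<times> real, 'e \<times> real) chart" where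
  "line_chart c \<equiv> prod_chart c (UNIV, \<lambda>s. s)"

lemma charts_prod_line: "charts (prod_manifold N real_line) = line_chart ` charts N"
  by (auto simp: prod_manifold_def real_line_def)

lemma inv_coord_line_chart:
  assumes "c \<in> charts N" "x \<in> img c"
  shows "inv_coord (line_chart c) (x, s) = (inv_coord c x, s)"
proof -
  have "inj_on (coord (line_chart c)) (chart_dom (line_chart c))"
    using coord_inj[OF assms(1)] by (auto simp: prod_chart_def inj_on_def)
  moreover have "coord (line_chart c) (inv_coord c x, s) = (x, s)"
    using coord_inv_coord[OF assms(2)] by (simp add: prod_chart_def)
  moreover have "(inv_coord c x, s) \<in> chart_dom (line_chart c)"
    using inv_coord_in_dom[OF assms(2)] by (simp add: prod_chart_def)
  ultimately show ?thesis unfolding inv_coord_def by (metis inv_into_f_f)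
qed

lemma differential_snd_line_chart:
  assumes "c \<in> charts N" "x \<in> img c"
  shows "differential (line_chart c) snd (inv_coord c x, s) v = snd v"
proof -
  have "frechet_derivative (snd \<circ> inv_coord (line_chart c)) (at (x, s)) = frechet_derivative snd (at (x, s))"
    by (rule frechet_derivative_local_cong[of "img c \<times> UNIV"])
       (use assms img_open[OF assms(1)] inv_coord_line_chart[OF assms(1)] in \<open>auto intro: open_Times\<close>)
  also have "\<dots> = snd"
    using frechet_derivative_at[OF bounded_linear_imp_has_derivative[OF bounded_linear_snd], of "(x, s)"] by simp
  finally show ?thesis
    using coord_inv_coord[OF assms(2)] by (simp add: differential_def prod_chart_def)
qed

text \<open>The pullback uses an arbitrary chart \<open>d\<close> around the point. The derivative of the projection, read in
\<open>d\<close>, is the derivative of the transition map from \<open>c\<close> to \<open>d\<close>, so the transformation law leads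
back to the chart \<open>c\<close>.\<close>

lemma pullback_fst_line_chart:
  assumes c: "c \<in> charts N" "x \<in> img c" and T: "tensor2_field N T"
  shows "pullback N fst T (line_chart c) (inv_coord c x, s) v w = T c (inv_coord c x) (fst v) (fst w)"
proof -
  let ?p = "inv_coord c x"
  define d where "d = (SOME d. d \<in> charts N \<and> ?p \<in> chart_dom d)"
  have p: "?p \<in> chart_dom c" and x: "coord c ?p = x"
    by (rule inv_coord_in_dom[OF c(2)], rule coord_inv_coord[OF c(2)])
  have d: "d \<in> charts N" "?p \<in> chart_dom d"
    using someI[of "\<lambda>d. d \<in> charts N \<and> ?p \<in> chart_dom d", OF conjI[OF c(1) p]]
    unfolding d_def by blast+
  let ?O = "coord c ` (chart_dom c \<inter> chart_dom d)"
  have xO: "x \<in> ?O" using p d x by force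
  have O: "y \<in> img c" if "y \<in> ?O" for y using that by (auto simp: img_def)
  have "frechet_derivative (coord d \<circ> fst \<circ> inv_coord (line_chart c)) (at (x, s)) =
      frechet_derivative (\<lambda>q. transition c d (fst q)) (at (x, s))"
  proof (rule frechet_derivative_local_cong[of "?O \<times> UNIV"])
    show "open (?O \<times> (UNIV :: real set))" by (intro open_Times chart_overlap_open c d open_UNIV)
    show "(coord d \<circ> fst \<circ> inv_coord (line_chart c)) q = transition c d (fst q)" if "q \<in> ?O \<times> UNIV" for q
      using inv_coord_line_chart[OF c(1) O[of "fst q"], of "snd q"] that
      by (auto simp: transition_def)
  qed (use xO in auto)
  moreover have "dd (\<lambda>q. transition c d (fst q)) (x, s) v = dd (transition c d) x (fst v)" for v
    by (rule dd_fst[OF transition_smooth[OF c(1) d(1)] xO])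
  moreover have "T c ?p (fst v) (fst w) = T d ?p (dd (transition c d) x (fst v)) (dd (transition c d) x (fst w))"
    using tensor2_field_change[OF T c(1) d(1) p d(2)] unfolding x .
  ultimately show ?thesis
    unfolding pullback_def d_def[symmetric] fst_conv Let_def
    using x by (simp add: prod_chart_def)
qed

lemma local_rep_warped:
  assumes "c \<in> charts N" "x \<in> img c" and "tensor2_field N T"
  shows "local_rep (line_chart c) (warped_metric N T f) (x, s) =
    warped_coord (local_rep c T) (\<lambda>y. f (inv_coord c y)) (x, s)"
  by (intro ext)
    (simp add: local_rep_def inv_coord_line_chart[OF assms(1,2)] warped_metric_def warped_coord_def
      pullback_fst_line_chart[OF assms] differential_snd_line_chart[OF assms(1,2)])

end

text \<open>The Ricci flow on the warped product over a base manifold that may be non-compact; compactness is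
added below, for the maximum principle.\<close>

locale warped_flow = manifold_atlas N for N :: "('a, 'e::euclidean_space) manifold" +
  fixes u :: "'a \<times> real \<Rightarrow> real" and h :: "real \<Rightarrow> ('a, 'e) tensor2"
  assumes smooth_u: "smooth_ancient_function N u"
    and smooth_h: "smooth_ancient_metrics N h"
    and flow: "ancient_ricci_flow (prod_manifold N real_line) (\<lambda>t. warped_metric N (h t) (\<lambda>p. u (p, t)))"
begin

abbreviation "H c t \<equiv> local_rep c (h t)"
abbreviation "U c t x \<equiv> u (inv_coord c x, t)"

lemma metric_at: "t < 0 \<Longrightarrow> riemannian_metric N (h t)"
  using smooth_h by (simp add: smooth_ancient_metrics_def)

lemma tensor_at: "t < 0 \<Longrightarrow> tensor2_field N (h t)"
  using metric_at by (simp add: riemannian_metric_def)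

lemma inner_form_H:
  assumes "c \<in> charts N" "t < 0" "x \<in> img c"
  shows "inner_form (H c t x)"
proof -
  note p = inv_coord_in_dom[OF assms(3)]
  have "bilinear (h t c (inv_coord c x))"
    using tensor_at[OF assms(2), unfolded tensor2_field_def, THEN conjunct1] assms(1) p by blast
  moreover have "(\<forall>v w. h t c (inv_coord c x) v w = h t c (inv_coord c x) w v) \<and>
      (\<forall>v. v \<noteq> 0 \<longrightarrow> h t c (inv_coord c x) v v > 0)"
    using metric_at[OF assms(2), unfolded riemannian_metric_def, THEN conjunct2, THEN conjunct2] assms(1) p
    by blast
  ultimately show ?thesis unfolding inner_form_def local_rep_def by blast
qed

lemma smooth_on_U:
  assumes "c \<in> charts N"
  shows "smooth_on (\<lambda>(x, t). U c t x) (img c \<times> {..<0})"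
  using smooth_u assms by (simp add: smooth_ancient_function_def)

lemma smooth_on_H:
  assumes "c \<in> charts N"
  shows "smooth_on (\<lambda>(x, t). H c t x v w) (img c \<times> {..<0})"
  using smooth_h assms by (simp add: smooth_ancient_metrics_def)

lemma local_metric_function_chart:
  assumes c: "c \<in> charts N" and t: "t < 0"
  shows "local_metric_function (img c) (H c t) (U c t)"
  using smooth_on_slice_fst(1)[OF smooth_on_H[OF c] img_open[OF c] open_lessThan, of t]
    smooth_on_slice_fst(1)[OF smooth_on_U[OF c] img_open[OF c] open_lessThan, of t]
    t img_open[OF c] inner_form_H[OF c t]
  by (intro local_metric_function.intro local_metric.intro local_metric_function_axioms.intro) auto

lemma warped_flow_chart:
  assumes c: "c \<in> charts N" and t: "t < 0" and x: "x \<in> img c"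
  shows "((\<lambda>\<tau>. warped_coord (H c \<tau>) (U c \<tau>) (x, 0) v w) has_real_derivative
    - 2 * ricci_coord (warped_coord (H c t) (U c t)) (x, 0) v w) (at t)"
proof -
  let ?p = "inv_coord c x"
  let ?g = "\<lambda>t. warped_metric N (h t) (\<lambda>p. u (p, t))"
  have p: "coord c ?p = x" using coord_inv_coord[OF x] .
  have "line_chart c \<in> charts (prod_manifold N real_line)" using c charts_prod_line by simp
  moreover have "(?p, 0) \<in> chart_dom (line_chart c)"
    using inv_coord_in_dom[OF x] by (simp add: prod_chart_def)
  ultimately have "((\<lambda>\<tau>. ?g \<tau> (line_chart c) (?p, 0) v w) has_real_derivative
      - 2 * ricci (?g t) (line_chart c) (?p, 0) v w) (at t)"
    using flow t unfolding ancient_ricci_flow_def by blast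
  moreover have "?g \<tau> (line_chart c) (?p, 0) v w = warped_coord (H c \<tau>) (U c \<tau>) (x, 0) v w"
    if "\<tau> \<in> {..<0}" for \<tau>
    using local_rep_warped[OF c x tensor_at, of \<tau> "\<lambda>p. u (p, \<tau>)" 0] that
      inv_coord_line_chart[OF c x, of 0] by (simp add: local_rep_def[of "line_chart c"])
  ultimately have "((\<lambda>\<tau>. warped_coord (H c \<tau>) (U c \<tau>) (x, 0) v w) has_real_derivative
      - 2 * ricci (?g t) (line_chart c) (?p, 0) v w) (at t)"
    using has_field_derivative_transform_within_open[of _ _ t "{..<0}"] t by auto
  moreover have "ricci (?g t) (line_chart c) (?p, 0) v w =
      ricci_coord (warped_coord (H c t) (U c t)) (x, 0) v w"
  proof -
    have "coord (line_chart c) (?p, 0) = (x, 0)" using p by (simp add: prod_chart_def)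
    moreover have "riemann_curvature (local_rep (line_chart c) (?g t)) (x, 0) a v w =
        riemann_curvature (warped_coord (H c t) (U c t)) (x, 0) a v w" for a
      by (rule riemann_curvature_cong[of "img c \<times> UNIV"])
        (use local_rep_warped[OF c _ tensor_at[OF t]] x img_open[OF c] in \<open>auto intro: open_Times\<close>)
    ultimately show ?thesis by (simp add: ricci_eq_ricci_coord ricci_coord_def)
  qed
  ultimately show ?thesis by simp
qed

text \<open>The equation for \<open>h\<close> is the Ricci flow evaluated on horizontal vectors. The equation for \<open>u\<close> comes
from the vertical unit coordinate vector, for which the flow describes \<open>e\<^sup>2\<^sup>u\<close>; dividing by \<open>2 e\<^sup>2\<^sup>u\<close> is
possible because \<open>u\<close> is known to be differentiable in time.\<close>

lemma local_flow_chart: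
  assumes c: "c \<in> charts N"
  shows "local_flow (img c) (H c) (U c)"
proof
  show "open (img c)" by (rule img_open[OF c])
  show "inner_form (H c t x)" if "t < 0" "x \<in> img c" for t x by (rule inner_form_H[OF c that])
  show "smooth_on (\<lambda>(x, t). H c t x v w) (img c \<times> {..<0})" for v w by (rule smooth_on_H[OF c])
  show "smooth_on (\<lambda>(x, t). U c t x) (img c \<times> {..<0})" by (rule smooth_on_U[OF c])
  fix t :: real and x assume t: "t < 0" and x: "x \<in> img c"
  interpret local_metric_function "img c" "H c t" "U c t" by (rule local_metric_function_chart[OF c t])
  show "((\<lambda>\<tau>. H c \<tau> x v w) has_real_derivative
      - 2 * (ricci_coord (H c t) x v w - hessian (H c t) (U c t) x v w - dd (U c t) x v * dd (U c t) x w)) (at t)"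
    for v w
    using warped_flow_chart[OF c t x, of "(v, 0)" "(w, 0)"] ricci_warped_horizontal[OF x]
    by (simp add: warped_coord_def)
  have "((\<lambda>\<tau>. exp (2 * U c \<tau> x)) has_real_derivative
      2 * exp (2 * U c t x) * (laplacian (H c t) (U c t) x + grad_square (H c t) (U c t) x)) (at t)"
  proof -
    have "(\<lambda>\<tau>. warped_coord (H c \<tau>) (U c \<tau>) (x, 0) (0, 1) (0, 1)) = (\<lambda>\<tau>. H c \<tau> x 0 0 + exp (2 * U c \<tau> x))"
      by (simp add: warped_coord_def)
    moreover have "H c \<tau> x 0 0 = 0" if "\<tau> \<in> {..<0}" for \<tau>
      using linear_0[OF inner_form_linear(1)[OF inner_form_H[OF c _ x]]] that by simp
    ultimately show ?thesis
      using warped_flow_chart[OF c t x, of "(0, 1)" "(0, 1)"] ricci_warped_vertical[OF x, of 0] t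
        has_field_derivative_transform_within_open[of "\<lambda>\<tau>. H c \<tau> x 0 0 + exp (2 * U c \<tau> x)" _ t "{..<0}"
          "\<lambda>\<tau>. exp (2 * U c \<tau> x)"] by (simp add: mult.assoc)
  qed
  moreover have U: "((\<lambda>\<tau>. U c \<tau> x) has_real_derivative dd (\<lambda>\<tau>. U c \<tau> x) t 1) (at t)"
    by (rule smooth_on_real_derivative[of _ "{..<0}"])
      (use smooth_on_slice_snd(1)[OF smooth_on_U[OF c] img_open[OF c] open_lessThan x] t in auto)
  then have "((\<lambda>\<tau>. exp (2 * U c \<tau> x)) has_real_derivative
      exp (2 * U c t x) * (2 * dd (\<lambda>\<tau>. U c \<tau> x) t 1)) (at t)"
    by (auto intro!: derivative_eq_intros)
  ultimately have "2 * exp (2 * U c t x) * (laplacian (H c t) (U c t) x + grad_square (H c t) (U c t) x) =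
      exp (2 * U c t x) * (2 * dd (\<lambda>\<tau>. U c \<tau> x) t 1)"
    by (rule DERIV_unique)
  then have "dd (\<lambda>\<tau>. U c \<tau> x) t 1 = laplacian (H c t) (U c t) x + grad_square (H c t) (U c t) x"
    by simp
  then show "((\<lambda>\<tau>. U c \<tau> x) has_real_derivative
      laplacian (H c t) (U c t) x + grad_square (H c t) (U c t) x) (at t)"
    using U by simp
qed

end

section \<open>The maximum principle on the compact manifold\<close>

context warped_flow
begin

lemma chart_dom_topspace: "c \<in> charts N \<Longrightarrow> p \<in> chart_dom c \<Longrightarrow> p \<in> topspace (topo N)"
  unfolding charts_cover[symmetric] by (rule UN_I)

lemma chart_around:
  assumes "p \<in> topspace (topo N)"
  obtains c where "c \<in> charts N" "p \<in> chart_dom c"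
  using assms unfolding charts_cover[symmetric] by (rule UN_E)

definition gradient_square_at :: "('a, 'e) chart \<Rightarrow> 'a \<Rightarrow> real \<Rightarrow> real" where
  "gradient_square_at c p t = grad_square (H c t) (U c t) (coord c p)"

text \<open>The derivative \<open>D\<close> of the transition map is an isometry for the two local metrics, hence injective and
therefore bijective, and the chain rule shows that it maps gradient to gradient.\<close>

lemma gradient_square_at_chart_independent:
  assumes c: "c \<in> charts N" "p \<in> chart_dom c" and d: "d \<in> charts N" "p \<in> chart_dom d" and t: "t < 0"
  shows "gradient_square_at c p t = gradient_square_at d p t"
proof -
  let ?x = "coord c p" and ?y = "coord d p"
  let ?O = "coord c ` (chart_dom c \<inter> chart_dom d)"
  let ?T = "transition c d"
  define D where "D = frechet_derivative ?T (at ?x)"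
  have x: "?x \<in> img c" and y: "?y \<in> img d" using c d by (auto intro: coord_in_img)
  have O: "open ?O" "?x \<in> ?O" using chart_overlap_open[OF c(1) d(1)] c d by auto
  have Tx: "?T ?x = ?y" using inv_coord_coord[OF c] by (simp add: transition_def)
  interpret lc: local_metric_function "img c" "H c t" "U c t" by (rule local_metric_function_chart[OF c(1) t])
  interpret ld: local_metric_function "img d" "H d t" "U d t" by (rule local_metric_function_chart[OF d(1) t])
  have derT: "(?T has_derivative D) (at ?x)"
    unfolding D_def by (rule smooth_on_has_derivative[OF transition_smooth[OF c(1) d(1)] O(2)])
  then have linD: "linear D" using has_derivative_linear by blast
  have HD: "H c t ?x v w = H d t ?y (D v) (D w)" for v w
    using tensor2_field_change[OF tensor_at[OF t] c(1) d(1) c(2) d(2)]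
    by (simp add: local_rep_def inv_coord_coord c d D_def)
  have "v = 0" if "D v = 0" for v
  proof (rule ccontr)
    assume "v \<noteq> 0"
    then have "H c t ?x v v > 0" using lc.inner[OF x] by (simp add: inner_form_def)
    moreover have "H d t ?y 0 0 = 0" using linear_0[OF inner_form_linear(2)[OF ld.inner[OF y]]] .
    ultimately show False using HD[of v v] that by simp
  qed
  then have "surj D" using linear_injective_imp_surjective[OF linD] linear_injective_0[OF linD] by blast
  have "dd (U c t) ?x v = dd (U d t) ?y (D v)" for v
  proof -
    have "dd (U c t) ?x v = dd (\<lambda>z. U d t (?T z)) ?x v"
      by (rule dd_cong[OF O]) (auto simp: transition_def inv_coord_coord c(1) d(1))
    also have "\<dots> = dd (U d t) ?y (D v)"
      using has_derivative_compose[OF derT, of "U d t"] smooth_on_has_derivative[OF ld.smooth_U y]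
      unfolding Tx by (intro dd_eqI[of "\<lambda>z. U d t (?T z)" "\<lambda>v. dd (U d t) ?y (D v)"])
    finally show ?thesis .
  qed
  then have "H d t ?y (D (lc.X ?x)) (D v) = dd (U d t) ?y (D v)" for v
    using lc.gradient_works[OF x, of v] HD by simp
  then have "H d t ?y (D (lc.X ?x)) z = dd (U d t) ?y z" for z
    using \<open>surj D\<close> by (metis surjD)
  then have "ld.X ?y = D (lc.X ?x)"
    unfolding gradient_def[of "H d t"] by (rule riesz_eqI[OF ld.inner[OF y]])
  then show ?thesis
    unfolding gradient_square_at_def grad_square_def using HD by simp
qed

text \<open>The function \<open>\<phi> = |\<nabla>u|\<^sup>2\<close> on \<open>N\<close>.\<close>

definition gradient_square :: "'a \<Rightarrow> real \<Rightarrow> real" where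
  "gradient_square p t = gradient_square_at (SOME c. c \<in> charts N \<and> p \<in> chart_dom c) p t"

lemma gradient_square_in_chart:
  assumes "c \<in> charts N" "p \<in> chart_dom c" "t < 0"
  shows "gradient_square p t = grad_square (H c t) (U c t) (coord c p)"
proof -
  let ?P = "\<lambda>c. c \<in> charts N \<and> p \<in> chart_dom c"
  have "?P (SOME c. ?P c)" using assms(1,2) by (intro someI[of ?P c]) auto
  then show ?thesis
    using gradient_square_at_chart_independent[OF _ _ assms(1,2,3)]
    by (simp add: gradient_square_def gradient_square_at_def)
qed

lemma gradient_square_nonneg:
  assumes "c \<in> charts N" "p \<in> chart_dom c" "t < 0"
  shows "gradient_square p t \<ge> 0"
proof -
  interpret local_metric_function "img c" "H c t" "U c t"
    by (rule local_metric_function_chart[OF assms(1,3)])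
  have "coord c p \<in> img c" by (rule coord_in_img[OF assms(2)])
  then show ?thesis
    unfolding gradient_square_in_chart[OF assms] grad_square_def
    using inner[of "coord c p"] linear_0[OF inner_form_linear(2)[OF inner, of "coord c p" 0]]
    by (cases "X (coord c p) = 0") (auto simp: inner_form_def less_imp_le)
qed

lemma continuous_map_gradient_square:
  assumes "t1 < 0"
  shows "continuous_map (prod_topology (topo N) (top_of_set {t0..t1})) euclideanreal
    (\<lambda>q. (snd q - t0) * gradient_square (fst q) (snd q))"
proof (rule pasting_lemma[where I = "charts N" and T = "\<lambda>c. chart_dom c \<times> {t0..t1}"
      and f = "\<lambda>c q. (snd q - t0) * grad_square (H c (snd q)) (U c (snd q)) (coord c (fst q))"])
  let ?X = "prod_topology (topo N) (top_of_set {t0..t1})"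
  fix c assume c: "c \<in> charts N"
  interpret local_flow "img c" "H c" "U c" by (rule local_flow_chart[OF c])
  show "openin ?X (chart_dom c \<times> {t0..t1})"
    using chart_open[OF c] by (simp add: openin_prod_Times_iff)
  have sub: "subtopology ?X (chart_dom c \<times> {t0..t1}) =
      prod_topology (subtopology (topo N) (chart_dom c)) (top_of_set {t0..t1})"
    unfolding subtopology_Times by (simp add: subtopology_subtopology)
  have "continuous_map (subtopology ?X (chart_dom c \<times> {t0..t1})) (top_of_set (img c)) (coord c \<circ> fst)"
    unfolding sub
    by (rule continuous_map_compose[OF continuous_map_fst
          homeomorphic_imp_continuous_map[OF chart_homeomorphic[OF c]]])
  moreover have "continuous_map (subtopology ?X (chart_dom c \<times> {t0..t1})) (top_of_set {t0..t1}) snd"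
    unfolding sub by (rule continuous_map_snd)
  ultimately have "continuous_map (subtopology ?X (chart_dom c \<times> {t0..t1}))
      (prod_topology (top_of_set (img c)) (top_of_set {t0..t1})) (\<lambda>q. (coord c (fst q), snd q))"
    by (intro continuous_map_pairedI) (simp_all only: o_def)
  then have 1: "continuous_map (subtopology ?X (chart_dom c \<times> {t0..t1}))
      (top_of_set (img c \<times> {t0..t1})) (\<lambda>q. (coord c (fst q), snd q))"
    by simp
  have 2: "continuous_map (top_of_set (img c \<times> {t0..t1})) euclideanreal
      (\<lambda>q. (snd q - t0) * grad_square (H c (snd q)) (U c (snd q)) (fst q))"
  proof -
    have "continuous_on (img c \<times> {..<0}) (\<lambda>(x, t). grad_square (H c t) (U c t) x)"
      by (rule smooth_on_continuous[OF smooth_on_grad_square_spacetime])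
    then have "continuous_on (img c \<times> {t0..t1}) (\<lambda>(x, t). grad_square (H c t) (U c t) x)"
      by (rule continuous_on_subset) (use assms in auto)
    then have "continuous_on (img c \<times> {t0..t1}) (\<lambda>q. grad_square (H c (snd q)) (U c (snd q)) (fst q))"
      by (simp only: case_prod_beta')
    then have "continuous_on (img c \<times> {t0..t1})
        (\<lambda>q. (snd q - t0) * grad_square (H c (snd q)) (U c (snd q)) (fst q))"
      by (intro continuous_intros)
    then show ?thesis by simp
  qed
  show "continuous_map (subtopology ?X (chart_dom c \<times> {t0..t1})) euclideanreal
      (\<lambda>q. (snd q - t0) * grad_square (H c (snd q)) (U c (snd q)) (coord c (fst q)))"
    using continuous_map_compose[OF 1 2] by (simp add: o_def)
next
  fix c d q
  assume cd: "c \<in> charts N" "d \<in> charts N"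
    and q: "q \<in> topspace (prod_topology (topo N) (top_of_set {t0..t1})) \<inter>
        (chart_dom c \<times> {t0..t1}) \<inter> (chart_dom d \<times> {t0..t1})"
  have "fst q \<in> chart_dom c" "fst q \<in> chart_dom d" "snd q < 0" using q assms by (auto simp: mem_Times_iff)
  then show "(snd q - t0) * grad_square (H c (snd q)) (U c (snd q)) (coord c (fst q)) =
      (snd q - t0) * grad_square (H d (snd q)) (U d (snd q)) (coord d (fst q))"
    using gradient_square_in_chart[OF cd(1)] gradient_square_in_chart[OF cd(2)] by metis
next
  fix q assume q: "q \<in> topspace (prod_topology (topo N) (top_of_set {t0..t1}))"
  then have "fst q \<in> topspace (topo N)" "snd q \<in> {t0..t1}" by auto
  moreover obtain c where c: "c \<in> charts N" "fst q \<in> chart_dom c"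
    using chart_around[OF calculation(1)] .
  ultimately show "\<exists>c. c \<in> charts N \<and> q \<in> chart_dom c \<times> {t0..t1} \<and>
      (snd q - t0) * gradient_square (fst q) (snd q) =
      (snd q - t0) * grad_square (H c (snd q)) (U c (snd q)) (coord c (fst q))"
    using gradient_square_in_chart[OF c, of "snd q"] \<open>snd q \<in> {t0..t1}\<close> assms
    by (intro exI[of _ c]) (auto simp: mem_Times_iff)
qed

text \<open>At a space-time maximum of \<open>F = (t - t\<^sub>0) \<phi>\<close> over times up to \<open>t\<close> the left time derivative of \<open>F\<close> is
\<open>\<ge> 0\<close>, whence \<open>0 \<le> \<phi> + (t - t\<^sub>0) \<partial>\<^sub>t\<phi> \<le> \<phi> - 2 (t - t\<^sub>0) \<phi>\<^sup>2\<close>.\<close>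

lemma time_weighted_gradient_bound_at_max:
  assumes c: "c \<in> charts N" "p \<in> chart_dom c" and t: "t0 < t" "t < 0"
    and max: "\<And>p' t'. p' \<in> topspace (topo N) \<Longrightarrow> t0 \<le> t' \<Longrightarrow> t' \<le> t \<Longrightarrow>
      (t' - t0) * gradient_square p' t' \<le> (t - t0) * gradient_square p t"
  shows "(t - t0) * gradient_square p t \<le> 1 / 2"
proof -
  interpret local_flow "img c" "H c" "U c" by (rule local_flow_chart[OF c(1)])
  let ?x = "coord c p"
  let ?\<phi> = "\<lambda>\<tau>. grad_square (H c \<tau>) (U c \<tau>) ?x"
  let ?F = "\<lambda>\<tau>. (\<tau> - t0) * ?\<phi> \<tau>"
  have x: "?x \<in> img c" by (rule coord_in_img[OF c(2)])
  note top = chart_dom_topspace[OF c(1)]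
  have spatial: "grad_square (H c t) (U c t) y \<le> ?\<phi> t" if y: "y \<in> img c" for y
    using max[of "inv_coord c y" t] inv_coord_in_dom[OF y] top t coord_inv_coord[OF y]
      gradient_square_in_chart[OF c(1) inv_coord_in_dom[OF y] t(2)] gradient_square_in_chart[OF c t(2)]
    by simp
  obtain D where D: "(?\<phi> has_real_derivative D) (at t)" "D \<le> - 2 * (?\<phi> t)\<^sup>2"
    using grad_square_decays_at_max[OF t(2) x spatial] by blast
  have derF: "(?F has_real_derivative ?\<phi> t + (t - t0) * D) (at t)"
    by (auto intro!: derivative_eq_intros D(1))
  have "\<not> ?\<phi> t + (t - t0) * D < 0"
  proof
    assume "?\<phi> t + (t - t0) * D < 0"
    then obtain d where d: "d > 0" "\<And>r. 0 < r \<Longrightarrow> r < d \<Longrightarrow> ?F t < ?F (t - r)"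
      using DERIV_neg_dec_left[OF derF] by blast
    \<comment> \<open>going back from \<open>t\<close> by \<open>r\<close> stays in the range of strict decrease and does not pass \<open>t0\<close>\<close>
    define r where "r = min (d / 2) (t - t0)"
    have r: "0 < r" "r < d" "r \<le> t - t0" using d(1) t by (auto simp: r_def)
    have "?F (t - r) \<le> ?F t"
      using max[OF top[OF c(2)], of "t - r"] r t gradient_square_in_chart[OF c, of t]
        gradient_square_in_chart[OF c, of "t - r"] by simp
    then show False using d(2)[of r] r by simp
  qed
  moreover have "(t - t0) * D \<le> (t - t0) * (- 2 * (?\<phi> t)\<^sup>2)"
    using D(2) t by (intro mult_left_mono) auto
  ultimately have ineq: "2 * (t - t0) * (?\<phi> t)\<^sup>2 \<le> ?\<phi> t" by (simp add: algebra_simps)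
  have nn: "?\<phi> t \<ge> 0" using gradient_square_nonneg[OF c t(2)] gradient_square_in_chart[OF c t(2)] by simp
  have "(t - t0) * ?\<phi> t \<le> 1 / 2"
  proof (cases "?\<phi> t = 0")
    case False
    then have pos: "?\<phi> t > 0" using nn by simp
    have "(2 * (t - t0) * ?\<phi> t) * ?\<phi> t \<le> 1 * ?\<phi> t" using ineq by (simp add: power2_eq_square mult.assoc)
    then have "2 * (t - t0) * ?\<phi> t \<le> 1" using pos by (rule mult_right_le_imp_le)
    moreover have "2 * (t - t0) * ?\<phi> t = 2 * ((t - t0) * ?\<phi> t)" by simp
    ultimately show ?thesis by linarith
  qed simp
  then show ?thesis using gradient_square_in_chart[OF c t(2)] by simp
qed

end

locale compact_warped_flow = warped_flow +
  assumes compact_N: "compact_space (topo N)"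
begin

text \<open>The weight \<open>t - t\<^sub>0\<close> vanishes at the initial time, so a maximum over \<open>N \<times> [t\<^sub>0, t\<^sub>1]\<close> is either \<open>0\<close> or
attained at a later time.\<close>

lemma time_weighted_gradient_bound:
  assumes t: "t0 < t1" "t1 < 0" and p: "p \<in> topspace (topo N)"
  shows "(t1 - t0) * gradient_square p t1 \<le> 1 / 2"
proof -
  let ?X = "prod_topology (topo N) (top_of_set {t0..t1})"
  let ?F = "\<lambda>q. (snd q - t0) * gradient_square (fst q) (snd q)"
  have "compact_space ?X"
    using compact_N by (simp add: compact_space_prod_topology compact_space_subtopology)
  then have "compactin ?X (topspace ?X)" by (simp add: compact_space_def)
  then have "compactin euclideanreal (?F ` topspace ?X)"
    by (rule image_compactin[OF _ continuous_map_gradient_square[OF t(2)]])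
  then have "compact (?F ` topspace ?X)" by simp
  moreover have p1: "(p, t1) \<in> topspace ?X" using p t by simp
  ultimately obtain m where m: "m \<in> ?F ` topspace ?X" "\<And>y. y \<in> ?F ` topspace ?X \<Longrightarrow> y \<le> m"
    using compact_attains_sup[of "?F ` topspace ?X"] by blast
  then obtain p' t' where q: "p' \<in> topspace (topo N)" "t0 \<le> t'" "t' \<le> t1" "m = (t' - t0) * gradient_square p' t'"
    by auto
  obtain c where c: "c \<in> charts N" "p' \<in> chart_dom c" using chart_around[OF q(1)] .
  have le: "(s - t0) * gradient_square r s \<le> m" if "r \<in> topspace (topo N)" "t0 \<le> s" "s \<le> t1" for r s
    using m(2)[of "?F (r, s)"] that by force
  have "m \<le> 1 / 2"
  proof (cases "t' = t0")
    case False
    then show ?thesis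
      using time_weighted_gradient_bound_at_max[OF c, of t0 t'] q t le by simp
  qed (simp add: q)
  then show ?thesis using le[OF p, of t1] t by simp
qed

text \<open>The bound holds for every \<open>t\<^sub>0 < t\<close>; for a positive value of \<open>\<phi>\<close> it fails when \<open>t\<^sub>0\<close> is early enough.\<close>

lemma gradient_square_zero:
  assumes t: "t < 0" and p: "p \<in> topspace (topo N)"
  shows "gradient_square p t = 0"
proof (rule ccontr)
  assume nz: "gradient_square p t \<noteq> 0"
  obtain c where "c \<in> charts N" "p \<in> chart_dom c" using chart_around[OF p] .
  then have pos: "gradient_square p t > 0" using gradient_square_nonneg[of c p t] t nz by simp
  \<comment> \<open>with \<open>t\<^sub>0 = t - 1 / \<phi>\<close> the bound would read \<open>1 \<le> 1 / 2\<close>\<close>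
  have "(t - (t - 1 / gradient_square p t)) * gradient_square p t \<le> 1 / 2"
    using pos by (intro time_weighted_gradient_bound t p) simp
  then show False using pos by simp
qed

lemma stationary_in_chart:
  assumes c: "c \<in> charts N" and t: "t < 0" and x: "x \<in> img c"
  shows "dd (U c t) x v = 0"
    and "((\<lambda>\<tau>. U c \<tau> x) has_real_derivative 0) (at t)"
    and "((\<lambda>\<tau>. H c \<tau> x v w) has_real_derivative - 2 * ricci_coord (H c t) x v w) (at t)"
proof -
  interpret local_metric_function "img c" "H c t" "U c t" by (rule local_metric_function_chart[OF c t])
  have top: "inv_coord c y \<in> topspace (topo N)" if "y \<in> img c" for y
    by (rule chart_dom_topspace[OF c inv_coord_in_dom[OF that]])
  have \<phi>: "grad_square (H c t) (U c t) y = 0" if y: "y \<in> img c" for y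
    using gradient_square_zero[OF t top[OF y]] coord_inv_coord[OF y]
      gradient_square_in_chart[OF c inv_coord_in_dom[OF y] t] by simp
  have X: "X y = 0" if "y \<in> img c" for y
    using \<phi>[OF that] inner[OF that] unfolding grad_square_def inner_form_def by (metis less_irrefl)
  have dU: "dd (U c t) y v = 0" if "y \<in> img c" for y v
    using gradient_works[OF that, of v] X[OF that] linear_0[OF inner_form_linear(1)[OF inner[OF that]], of v]
    by simp
  show "dd (U c t) x v = 0" by (rule dU[OF x])
  have "dd X x b = dd (\<lambda>_. 0) x b" for b by (rule dd_cong[OF open_S x X])
  then have "A x b = 0" for b
    using dd_const linear_0[OF linear_christoffel_right[OF x]] X[OF x] by (simp add: covariant_def)
  then have "laplacian (H c t) (U c t) x = 0" by (simp add: laplacian_def endo_trace_def)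
  then show "((\<lambda>\<tau>. U c \<tau> x) has_real_derivative 0) (at t)"
    using local_flow.function_flow[OF local_flow_chart[OF c] t x] \<phi>[OF x] by simp
  have "dd (\<lambda>y. dd (U c t) y w) x v = 0" 
    using dd_cong[OF open_S x, of "\<lambda>y. dd (U c t) y w" "\<lambda>_. 0" v] dU by simp
  then have "hessian (H c t) (U c t) x v w = 0" by (simp add: hessian_def dU[OF x])
  then show "((\<lambda>\<tau>. H c \<tau> x v w) has_real_derivative - 2 * ricci_coord (H c t) x v w) (at t)"
    using local_flow.metric_flow[OF local_flow_chart[OF c] t x, of v w] dU[OF x] by simp
qed

text \<open>The differential vanishes, so \<open>u\<close> is constant on the preimages of balls in charts and its level sets
in \<open>N\<close> are open and closed.\<close>

lemma spatially_constant:
  assumes t: "t < 0" and p: "p \<in> topspace (topo N)" and q: "q \<in> topspace (topo N)"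
  shows "u (p, t) = u (q, t)"
proof -
  have nbhd: "\<exists>V. openin (topo N) V \<and> r \<in> V \<and> (\<forall>r'\<in>V. u (r', t) = u (r, t))"
    if rN: "r \<in> topspace (topo N)" for r
  proof -
    obtain c where c: "c \<in> charts N" "r \<in> chart_dom c" using chart_around[OF rN] .
    obtain e where e: "e > 0" "ball (coord c r) e \<subseteq> img c"
      using img_open[OF c(1)] coord_in_img[OF c(2)] open_contains_ball by blast
    interpret local_metric_function "img c" "H c t" "U c t" by (rule local_metric_function_chart[OF c(1) t])
    have "(U c t has_derivative (\<lambda>v. 0)) (at y within ball (coord c r) e)" if "y \<in> ball (coord c r) e" for y
    proof -
      have y: "y \<in> img c" using that e by blast
      have "frechet_derivative (U c t) (at y) = (\<lambda>v. 0)" by (intro ext stationary_in_chart(1)[OF c(1) t y])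
      then show ?thesis using has_derivative_at_withinI[OF smooth_on_has_derivative[OF smooth_U y]] by simp
    qed
    then obtain k where k: "\<And>y. y \<in> ball (coord c r) e \<Longrightarrow> U c t y = k"
      using has_derivative_zero_constant[OF convex_ball, of "coord c r" e "U c t"] by blast
    let ?V = "{r' \<in> chart_dom c. coord c r' \<in> ball (coord c r) e}"
    have uk: "u (r', t) = k" if "r' \<in> ?V" for r'
      using k[of "coord c r'"] that inv_coord_coord[OF c(1), of r'] by simp
    have r: "r \<in> ?V" using c e by simp
    show ?thesis
    proof (intro exI[of _ ?V] conjI ballI)
      show "openin (topo N) ?V" by (rule chart_preimage_open[OF c(1) open_ball])
      show "u (r', t) = u (r, t)" if "r' \<in> ?V" for r' using uk[OF that] uk[OF r] by simp
    qed (rule r)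
  qed
  let ?T = "{r \<in> topspace (topo N). u (r, t) = u (p, t)}"
  have "openin (topo N) ?T"
  proof (subst openin_subopen, intro ballI)
    fix r assume r: "r \<in> ?T"
    then obtain V where V: "openin (topo N) V" "r \<in> V" "\<forall>r'\<in>V. u (r', t) = u (r, t)"
      using nbhd[of r] by blast
    have "r' \<in> ?T" if "r' \<in> V" for r'
      using r openin_subset[OF V(1)] that bspec[OF V(3) that] by auto
    then show "\<exists>V. openin (topo N) V \<and> r \<in> V \<and> V \<subseteq> ?T"
      using V(1,2) by (intro exI[of _ V] conjI subsetI)
  qed
  moreover have "openin (topo N) (topspace (topo N) - ?T)"
  proof (subst openin_subopen, intro ballI)
    fix r assume r: "r \<in> topspace (topo N) - ?T"
    then obtain V where V: "openin (topo N) V" "r \<in> V" "\<forall>r'\<in>V. u (r', t) = u (r, t)"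
      using nbhd[of r] by blast
    have "r' \<in> topspace (topo N) - ?T" if "r' \<in> V" for r'
      using r openin_subset[OF V(1)] that bspec[OF V(3) that] by auto
    then show "\<exists>V. openin (topo N) V \<and> r \<in> V \<and> V \<subseteq> topspace (topo N) - ?T"
      using V(1,2) by (intro exI[of _ V] conjI subsetI)
  qed
  then have "closedin (topo N) ?T" by (auto simp: closedin_def)
  moreover have "connected_space (topo N)" using smooth_manifold_N by (simp add: smooth_manifold_def)
  ultimately have "?T = {} \<or> ?T = topspace (topo N)" unfolding connected_space_clopen_in by blast
  then have "q \<in> ?T" using p q by blast
  then show ?thesis by simp
qed

lemma constant_in_time:
  assumes p: "p \<in> topspace (topo N)" and t: "s < 0" "t < 0"
  shows "u (p, s) = u (p, t)"
proof -
  obtain c where c: "c \<in> charts N" "p \<in> chart_dom c" using chart_around[OF p] .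
  have "((\<lambda>\<tau>. u (p, \<tau>)) has_derivative (\<lambda>v. 0)) (at \<tau> within {..<0})" if "\<tau> \<in> {..<0}" for \<tau>
  proof -
    have "((\<lambda>\<tau>. u (p, \<tau>)) has_real_derivative 0) (at \<tau>)"
      using stationary_in_chart(2)[OF c(1) _ coord_in_img[OF c(2)], of \<tau>] that
      by (simp add: inv_coord_coord[OF c])
    then have "((\<lambda>\<tau>. u (p, \<tau>)) has_real_derivative 0) (at \<tau> within {..<0})"
      by (rule has_field_derivative_at_within)
    moreover have "(*) (0 :: real) = (\<lambda>v. 0)" by auto
    ultimately show ?thesis by (simp add: has_field_derivative_def)
  qed
  then obtain k where "\<And>\<tau>. \<tau> \<in> {..<0} \<Longrightarrow> u (p, \<tau>) = k"
    using has_derivative_zero_constant[of "{..<0}" "\<lambda>\<tau>. u (p, \<tau>)"] by auto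
  then show ?thesis using t by simp
qed

lemma ancient_ricci_flow_factor: "ancient_ricci_flow N h"
  unfolding ancient_ricci_flow_def
proof (intro conjI allI impI ballI smooth_h)
  fix t :: real and c p v w
  assume "t < 0" and c: "c \<in> charts N" "p \<in> chart_dom c"
  then show "((\<lambda>\<tau>. h \<tau> c p v w) has_real_derivative - 2 * ricci (h t) c p v w) (at t)"
    using stationary_in_chart(3)[OF c(1) _ coord_in_img[OF c(2)], of t v w]
    by (simp add: ricci_eq_ricci_coord local_rep_def[of c] inv_coord_coord[OF c])
qed

end

text \<open>The line has a single chart, the identity, so pulling back its metric \<open>ds\<^sup>2\<close> yields the square of
the differential of the coordinate \<open>s\<close> on the product.\<close>

lemma warped_metric_constant:
  assumes "f (fst q) = k"
  shows "warped_metric N T f c q =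
    product_metric N real_line T (\<lambda>d s v w. exp (2 * k) * line_metric d s v w) c q"
proof -
  have "(SOME d. d \<in> charts real_line \<and> snd q \<in> chart_dom d) = (UNIV, \<lambda>s. s)"
    by (rule some_equality) (auto simp: real_line_def)
  moreover have "inv_coord (UNIV :: real set, \<lambda>s. s) = (\<lambda>s. s)"
    by (rule ext) (simp add: inv_coord_def inv_into_f_eq)
  ultimately show ?thesis
    using assms
    by (intro ext) (simp add: warped_metric_def product_metric_def pullback_def line_metric_def
        differential_def o_def Let_def)
qed

theorem theorem1:
  fixes N :: "('a, 'e::euclidean_space) manifold"
    and u :: "'a \<times> real \<Rightarrow> real"
    and h :: "real \<Rightarrow> ('a, 'e) tensor2"
    and M :: "('a \<times> real, 'e \<times> real) manifold"
    and g :: "real \<Rightarrow> ('a \<times> real, 'e \<times> real) tensor2"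
  assumes "smooth_manifold N"
    and "compact_space (topo N)"
    and "DIM('e) \<ge> 2"
    and "smooth_ancient_function N u"
    and "smooth_ancient_metrics N h"
    and M: "M = prod_manifold N real_line"
    and g: "g = (\<lambda>t. warped_metric N (h t) (\<lambda>p. u (p, t)))"
    and "ancient_ricci_flow M g"
  shows "\<exists>k. (\<forall>p\<in>topspace (topo N). \<forall>t<0. u (p, t) = k) \<and>
    (\<forall>t<0. \<forall>c\<in>charts M. \<forall>q\<in>chart_dom c.
       g t c q = product_metric N real_line (h t)
         (\<lambda>d s v w. exp (2 * k) * line_metric d s v w) c q) \<and>
    ancient_ricci_flow N h"
proof -
  interpret compact_warped_flow N u h
    using assms by unfold_locales simp_all
  obtain k where k: "u (p, t) = k" if "p \<in> topspace (topo N)" "t < 0" for p t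
  proof (cases "topspace (topo N) = {}")
    case False
    then obtain p0 where "p0 \<in> topspace (topo N)" by blast
    then have "u (p, t) = u (p0, - 1)" if "p \<in> topspace (topo N)" "t < 0" for p t
      using spatially_constant[OF that(2,1)] constant_in_time[of p0 t "- 1"] that by simp
    then show ?thesis using that by blast
  qed (use that in blast)
  have "fst q \<in> topspace (topo N)" if "c \<in> charts M" "q \<in> chart_dom c" for c q
    using that chart_dom_topspace unfolding M charts_prod_line by (force simp: prod_chart_def)
  then have "g t c q = product_metric N real_line (h t)
      (\<lambda>d s v w. exp (2 * k) * line_metric d s v w) c q"
    if "t < 0" "c \<in> charts M" "q \<in> chart_dom c" for t c q
    unfolding g using that k by (intro warped_metric_constant) blast
  then show ?thesis using k ancient_ricci_flow_factor by blast
qed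

end
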